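(* Let $\Phi=(G,\varphi)$ be a $\mathbb{T}$-gain bicyclic graph (with $G$ connected) without pendant vertices. Write $\varphi(e_{ij})$ for the gain of the oriented edge from vertex $i$ to vertex $j$. Let $G_1,G_2,G_3,G_5,\dots,G_{11}$ be the labelled graphs listed in the context. Below, "$G=G_i$" means that $G$ is isomorphic to $G_i$ and its vertices are labelled accordingly, and "the cycle $i_1,i_2,\dots,i_k$" is the gain cycle of $\Phi$ with edges $i_1i_2,\ i_2i_3,\dots,i_{k-1}i_k,\ i_ki_1$. Then: (1) $r(\Phi)=2$ if and only if one of the following holds: - $G=G_5$, the cycle $1,2,3$ is of Type E and the cycle $1,2,4,3$ is of Type A; - $G=G_9$, and the cycles $1,2,3,4$ and $1,2,5,4$ are both of Type A. (2) $r(\Phi)=3$ if and only if $G=G_5$, the cycle $1,2,3$ is of Type C or D, and the cycle $1,2,4,3$ is of Type A. (3) $r(\Phi)=4$ if and only if one of the following holds: - $G=G_1$ and $\operatorname{Re}\left(-\varphi(e_{15})\frac{\varphi(e_{52})}{\varphi(e_{12})}\right)+\operatorname{Re}\left(-\varphi(e_{35})\frac{\varphi(e_{54})}{\varphi(e_{34})}\right)=0$; - $G=G_2$, the cycle $3,4,5,6$ is of Type A and the cycle $1,2,3$ is of Type E; - $G=G_3$, and the cycles $1,2,4,3$ and $4,5,6,7$ are both of Type A; - $G=G_5$, the cycle $1,2,3$ is of Type C, D or E, and the cycle $1,2,4,3$ is of Type B; - $G=G_6$ and $\operatorname{Re}\left(-\varphi(e_{15})\frac{\varphi(e_{52})}{\varphi(e_{12})}\right)+\operatorname{Re}\left(\frac{\varphi(e_{15})\varphi(e_{32})\varphi(e_{54})}{\varphi(e_{12})\varphi(e_{34})}\right)=0$;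 - $G=G_7$, the cycle $1,2,6$ is of Type E and the cycle $1,2,3,4,5,6$ is of Type A; - $G=G_8$ and $\varphi(e_{16})\varphi(e_{32})\varphi(e_{54})-\varphi(e_{16})\varphi(e_{34})\varphi(e_{52})+\varphi(e_{12})\varphi(e_{34})\varphi(e_{56})=0$; - $G=G_9$, and either the cycle $1,2,3,4$ is of Type A and the cycle $1,2,5,4$ is of Type B, or the cycle $1,2,3,4$ is of Type B and the cycle $1,2,5,4$ is of Type A or B; - $G=G_{10}$, the cycle $1,2,3,4,5$ is of Type E and the cycle $1,2,6,5$ is of Type A; - $G=G_{11}$, and the cycles $1,2,3,4,5,6$ and $1,2,7,6$ are both of Type A.
   Context: All graphs are finite and simple. Let $\mathbb{T}=\{z\in\mathbb{C}:|z|=1\}$. A $\mathbb{T}$-gain graph $\Phi=(G,\varphi)$ consists of a graph $G$ (the underlying graph) and a map $\varphi$ from the set of oriented edges of $G$ (each edge in both orientations) to $\mathbb{T}$ such that $\varphi(e_{ij})=\varphi(e_{ji})^{-1}=\overline{\varphi(e_{ji})}$, where $e_{ij}$ is the oriented edge from $v_i$ to $v_j$. Its adjacency matrix $A(\Phi)=(a_{ij})$ is the Hermitian matrix with $a_{ij}=\varphi(e_{ij})$ if $v_i,v_j$ are adjacent and $a_{ij}=0$ otherwise. The rank $r(\Phi)$ is the rank of $A(\Phi)$. A bicyclic graph is a connected graph whose number of edges equals its number of vertices plus one. A pendant vertex is a vertex of degree 1. Types of gain cycles. Let a gain cycle have vertices $v_1,\dots,v_n$ in cyclic order, with $w_i=\varphi(v_iv_{i+1})$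 for $1\le i\le n-1$ and $w_n=\varphi(v_nv_1)$ (gains of the edges oriented in the indicated direction). For $n$ even it is of Type A if $(-1)^{n/2}\overline{w_n}=w_1w_2\cdots w_{n-1}$, and of Type B otherwise. For $n$ odd it is of Type C, D or E according as $\operatorname{Re}\left((-1)^{(n-1)/2}w_1w_2\cdots w_n\right)$ is $>0$, $<0$ or $=0$. The graphs (vertex set $\{1,\dots,k\}$, $k$ the largest label; edge $ij$ joins $i$ and $j$): $G_1$: $12,15,25,34,35,45$ (two triangles sharing vertex 5). $G_2$: $12,23,13,34,45,56,36$ (a triangle and a 4-cycle sharing vertex 3). $G_3$: $12,24,34,13,45,56,67,47$ (two 4-cycles sharing vertex 4). $G_5$: $12,13,23,24,34$. $G_6$: $12,15,23,25,34,45$. $G_7$: $12,16,23,26,34,45,56$. $G_8$: $12,16,23,25,34,45,56$. $G_9$: $12,14,23,25,34,45$. $G_{10}$: $12,15,23,26,34,45,56$. $G_{11}$: $12,16,23,27,34,45,56,67$. *)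

theory Defs
  imports "HOL-Analysis.Analysis" "Graph_Theory.Pair_Digraph" "Graph_Theory.Digraph_Component"
begin

text \<open>A finite simple graph is a \<^locale>\<open>pair_graph\<close>, i.e. a finite symmetric loop-free set
  of ordered pairs; its arcs are exactly the oriented edges, and every edge contributes two arcs.\<close>

definition edges :: "'v pair_pre_digraph \<Rightarrow> 'v set set" where
  "edges G = (\<lambda>(u, v). {u, v}) ` parcs G"

text \<open>The qualified name keeps graph connectedness apart from topological connectedness.\<close>

definition bicyclic :: "'v pair_pre_digraph \<Rightarrow> bool" where
  "bicyclic G \<longleftrightarrow> pair_graph G \<and> Digraph_Component.connected (with_proj G)
     \<and> card (edges G) = card (pverts G) + 1"

text \<open>In a symmetric digraph the out-degree of a vertex is its degree in the simple graph.\<close>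

definition pendant_vertex :: "'v pair_pre_digraph \<Rightarrow> 'v \<Rightarrow> bool" where
  "pendant_vertex G v \<longleftrightarrow> v \<in> pverts G \<and> out_degree (with_proj G) v = 1"

text \<open>Gains of pairs that are not arcs are unconstrained and never used. On arcs the inverse is the
  complex conjugate, since the gains have modulus 1.\<close>

locale gain_graph = pair_graph G for G :: "'v pair_pre_digraph" +
  fixes \<phi> :: "'v \<times> 'v \<Rightarrow> complex"
  assumes gain_unit: "a \<in> parcs G \<Longrightarrow> cmod (\<phi> a) = 1"
    and gain_reverse: "(u, v) \<in> parcs G \<Longrightarrow> \<phi> (u, v) = inverse (\<phi> (v, u))"

text \<open>Rows and columns are indexed by the type \<^typ>\<open>'v\<close>, so this is the adjacency matrix of the
  gain graph only when \<open>pverts G = UNIV\<close>.\<close>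

definition adjacency_matrix ::
    "'v::finite pair_pre_digraph \<Rightarrow> ('v \<times> 'v \<Rightarrow> complex) \<Rightarrow> complex ^ 'v ^ 'v" where
  "adjacency_matrix G \<phi> = (\<chi> i j. if (i, j) \<in> parcs G then \<phi> (i, j) else 0)"

definition gain_rank :: "'v::finite pair_pre_digraph \<Rightarrow> ('v \<times> 'v \<Rightarrow> complex) \<Rightarrow> nat" where
  "gain_rank G \<phi> = rank (adjacency_matrix G \<phi>)"

text \<open>A gain cycle is given by the list \<open>[v\<^sub>1, \<dots>, v\<^sub>n]\<close> of its vertices in cyclic order;
  \<open>cycle_gains\<close> is the list \<open>[w\<^sub>1, \<dots>, w\<^sub>n]\<close>, whose last entry is the gain of the closing arc
  \<open>(v\<^sub>n, v\<^sub>1)\<close>. That the list really is a cycle of the graph is not part of the type predicates.\<close>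

definition cycle_gains :: "('v \<times> 'v \<Rightarrow> complex) \<Rightarrow> 'v list \<Rightarrow> complex list" where
  "cycle_gains \<phi> vs = map \<phi> (zip vs (rotate1 vs))"

definition type_A :: "('v \<times> 'v \<Rightarrow> complex) \<Rightarrow> 'v list \<Rightarrow> bool" where
  "type_A \<phi> vs \<longleftrightarrow> even (length vs) \<and>
     (-1) ^ (length vs div 2) * cnj (last (cycle_gains \<phi> vs)) = prod_list (butlast (cycle_gains \<phi> vs))"

definition type_B :: "('v \<times> 'v \<Rightarrow> complex) \<Rightarrow> 'v list \<Rightarrow> bool" where
  "type_B \<phi> vs \<longleftrightarrow> even (length vs) \<and>
     (-1) ^ (length vs div 2) * cnj (last (cycle_gains \<phi> vs)) \<noteq> prod_list (butlast (cycle_gains \<phi> vs))"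

definition type_C :: "('v \<times> 'v \<Rightarrow> complex) \<Rightarrow> 'v list \<Rightarrow> bool" where
  "type_C \<phi> vs \<longleftrightarrow> odd (length vs) \<and>
     Re ((-1) ^ ((length vs - 1) div 2) * prod_list (cycle_gains \<phi> vs)) > 0"

definition type_D :: "('v \<times> 'v \<Rightarrow> complex) \<Rightarrow> 'v list \<Rightarrow> bool" where
  "type_D \<phi> vs \<longleftrightarrow> odd (length vs) \<and>
     Re ((-1) ^ ((length vs - 1) div 2) * prod_list (cycle_gains \<phi> vs)) < 0"

definition type_E :: "('v \<times> 'v \<Rightarrow> complex) \<Rightarrow> 'v list \<Rightarrow> bool" where
  "type_E \<phi> vs \<longleftrightarrow> odd (length vs) \<and>
     Re ((-1) ^ ((length vs - 1) div 2) * prod_list (cycle_gains \<phi> vs)) = 0"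

definition labelled_graph :: "nat \<Rightarrow> (nat \<times> nat) set \<Rightarrow> nat pair_pre_digraph" where
  "labelled_graph k E = \<lparr> pverts = {1..k}, parcs = E \<union> E\<inverse> \<rparr>"

definition "G1 = labelled_graph 5 {(1,2), (1,5), (2,5), (3,4), (3,5), (4,5)}"
definition "G2 = labelled_graph 6 {(1,2), (2,3), (1,3), (3,4), (4,5), (5,6), (3,6)}"
definition "G3 = labelled_graph 7 {(1,2), (2,4), (3,4), (1,3), (4,5), (5,6), (6,7), (4,7)}"
definition "G5 = labelled_graph 4 {(1,2), (1,3), (2,3), (2,4), (3,4)}"
definition "G6 = labelled_graph 5 {(1,2), (1,5), (2,3), (2,5), (3,4), (4,5)}"
definition "G7 = labelled_graph 6 {(1,2), (1,6), (2,3), (2,6), (3,4), (4,5), (5,6)}"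
definition "G8 = labelled_graph 6 {(1,2), (1,6), (2,3), (2,5), (3,4), (4,5), (5,6)}"
definition "G9 = labelled_graph 5 {(1,2), (1,4), (2,3), (2,5), (3,4), (4,5)}"
definition "G10 = labelled_graph 6 {(1,2), (1,5), (2,3), (2,6), (3,4), (4,5), (5,6)}"
definition "G11 = labelled_graph 7 {(1,2), (1,6), (2,3), (2,7), (3,4), (4,5), (5,6), (6,7)}"

text \<open>\<open>labelling H G l\<close>: the map \<open>l\<close> is a graph isomorphism from the labelled graph \<open>H\<close> onto \<open>G\<close>,
  so \<open>l i\<close> is the vertex of \<open>G\<close> that carries the label \<open>i\<close>.\<close>

definition labelling :: "nat pair_pre_digraph \<Rightarrow> 'v pair_pre_digraph \<Rightarrow> (nat \<Rightarrow> 'v) \<Rightarrow> bool" where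
  "labelling H G l \<longleftrightarrow> bij_betw l (pverts H) (pverts G) \<and> parcs G = map_prod l l ` parcs H"

end

theory Submission
  imports Defs
begin

text \<open>
  The rank is computed by Gaussian elimination along edges. If \<open>x y\<close> is an edge, the block of the
  adjacency matrix on \<open>{x, y}\<close> is invertible, so the rank is 2 plus the rank of its Schur complement
  (\<open>rank_edge_pivot\<close>). Passing to the complement changes the entry between \<open>i\<close> and \<open>j\<close> by the gains of
  the walks of length three from \<open>i\<close> to \<open>j\<close> through that edge.

  This bounds the rank from below by combinatorics alone: rows and columns on which the adjacency
  matrix is triangular count towards the rank (\<open>rank_ge_triangular\<close>). In a gain graph of rank at most
  four, two edges \<open>x1 y1\<close> and \<open>x2 y2\<close> with \<open>x1\<close> adjacent to neither \<open>x2\<close> nor \<open>y2\<close> therefore have every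
  vertex in their neighbourhood (\<open>domination\<close>), as another vertex and a neighbour of it would be a
  third edge of a triangular pattern. A bicyclic graph without pendant vertices has one vertex of
  degree 4 or two vertices of degree 3, and all other degrees are 2 (\<open>branch_vertices\<close>). Domination
  and a few more triangular patterns leave only the ten graphs \<open>G1\<close>, \<open>G2\<close>, \<open>G3\<close> and \<open>G5\<close> to
  \<open>G11\<close> (\<open>low_rank_shapes\<close>): for a vertex of degree 4 two cycles sharing a vertex, each of
  length 3 or 4; for two vertices of degree 3 theta graphs with short paths. All graphs in which two disjoint cycles are joined by a path are excluded.

  For these ten graphs the rank is determined exactly. Except for \<open>G5\<close> and \<open>G9\<close>, two edges can be
  eliminated, which shows that the rank is at least four, and at most three vertices remain. The rank
  is four exactly if all entries on them vanish, and up to unit factors these entries are the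
  expressions by which the cycle types are defined: a diagonal entry is twice the real part of the
  gain of an odd cycle, up to sign, and an entry off the diagonal is the difference of the gains of
  the paths that form an even cycle. For \<open>G5\<close> and \<open>G9\<close> one edge is eliminated, and the rank of
  the remaining block on two or three vertices is computed.
\<close>

section \<open>Rank by elimination\<close>

definition pivot :: "'n \<Rightarrow> 'n \<Rightarrow> 'a::field ^ 'n ^ 'n \<Rightarrow> 'a ^ 'n ^ 'n" where
  "pivot p q A = (\<chi> i j. A $ i $ j - A $ i $ q * A $ p $ j / A $ p $ q)"

text \<open>The row \<open>p\<close> of \<open>A\<close> together with the rows of the pivoted matrix spans the row space of \<open>A\<close>,
  and it is independent of them, because the pivoted matrix vanishes in column \<open>q\<close>.\<close>

lemma rank_pivot:
  fixes A :: "'a::field ^ 'n ^ 'n"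
  assumes "A $ p $ q \<noteq> 0"
  shows "rank A = Suc (rank (pivot p q A))"
proof -
  let ?B = "pivot p q A"
  define c where "c i = A $ i $ q / A $ p $ q" for i
  have row_B: "row i ?B = row i A - c i *s row p A" for i
    by (simp add: vec_eq_iff row_def pivot_def c_def)
  have row_A: "row i A = row i ?B + c i *s row p A" for i
    by (simp add: row_B)
  have "row p A \<notin> vec.span (rows ?B)"
  proof
    have "vec.subspace {v :: 'a ^ 'n. v $ q = 0}"
      by (auto simp: vec.subspace_def)
    moreover have "rows ?B \<subseteq> {v. v $ q = 0}"
      using assms by (auto simp: rows_def row_def pivot_def)
    ultimately have "vec.span (rows ?B) \<subseteq> {v. v $ q = 0}"
      by (rule vec.span_minimal[rotated])
    moreover assume "row p A \<in> vec.span (rows ?B)"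
    ultimately show False
      using assms by (auto simp: row_def)
  qed
  moreover have "vec.span (rows A) = vec.span (insert (row p A) (rows ?B))"
  proof (intro vec.span_eq[THEN iffD2] conjI subsetI)
    fix v assume "v \<in> rows A"
    then obtain i where i: "v = row i A"
      by (auto simp: rows_def)
    have "v = row i ?B + c i *s row p A"
      unfolding i by (rule row_A)
    moreover have "row i ?B \<in> vec.span (insert (row p A) (rows ?B))"
      by (rule vec.span_base) (auto simp: rows_def)
    moreover have "row p A \<in> vec.span (insert (row p A) (rows ?B))"
      by (rule vec.span_base) simp
    ultimately show "v \<in> vec.span (insert (row p A) (rows ?B))"
      by (simp add: vec.span_add vec.span_scale)
  next
    fix v assume "v \<in> insert (row p A) (rows ?B)"
    moreover have row_mem: "row i A \<in> vec.span (rows A)" for i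
      by (rule vec.span_base) (auto simp: rows_def)
    moreover have "row i ?B \<in> vec.span (rows A)" for i
      unfolding row_B by (intro vec.span_diff vec.span_scale row_mem)
    ultimately show "v \<in> vec.span (rows A)"
      by (auto simp: rows_def)
  qed
  then have "rank A = vec.dim (insert (row p A) (rows ?B))"
    unfolding row_rank_def_gen by (rule vec.span_eq_dim)
  ultimately show ?thesis
    by (simp add: row_rank_def_gen vec.dim_insert)
qed

lemma rank_eq_0_iff:
  fixes A :: "'a::field ^ 'n ^ 'n"
  shows "rank A = 0 \<longleftrightarrow> (\<forall>i j. A $ i $ j = 0)"
proof
  assume rank_0: "rank A = 0"
  show "\<forall>i j. A $ i $ j = 0"
  proof (intro allI, rule ccontr)
    fix i j assume "A $ i $ j \<noteq> 0"
    then show False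
      using rank_pivot[of A i j] rank_0 by simp
  qed
next
  assume "\<forall>i j. A $ i $ j = 0"
  then have "rows A \<subseteq> {0}"
    by (auto simp: rows_def row_def vec_eq_iff)
  then show "rank A = 0"
    by (simp add: row_rank_def_gen)
qed

text \<open>The row of the first pair vanishes in all later columns, so eliminating that pair leaves those
  columns unchanged and the argument can be repeated.\<close>

lemma rank_ge_triangular:
  fixes A :: "'a::field ^ 'n ^ 'n"
  assumes "\<forall>(r, c) \<in> set ps. A $ r $ c \<noteq> 0"
    and "sorted_wrt (\<lambda>(r, _) (_, c). A $ r $ c = 0) ps"
  shows "length ps \<le> rank A"
  using assms
proof (induction ps arbitrary: A)
  case (Cons p ps)
  obtain r c where p: "p = (r, c)"
    by (cases p)
  let ?B = "pivot r c A"
  have same: "?B $ r' $ c' = A $ r' $ c'" if "(r'', c') \<in> set ps" for r' r'' c'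
    using Cons.prems(2) that by (auto simp: p pivot_def)
  have "length ps \<le> rank ?B"
  proof (rule Cons.IH)
    show "\<forall>(r', c') \<in> set ps. ?B $ r' $ c' \<noteq> 0"
      using Cons.prems(1) same by fastforce
    have "sorted_wrt (\<lambda>(r, _) (_, c). A $ r $ c = 0) ps"
      using Cons.prems(2) by simp
    then show "sorted_wrt (\<lambda>(r, _) (_, c). ?B $ r $ c = 0) ps"
      by (rule sorted_wrt_mono_rel[rotated]) (auto simp: same split: prod.splits)
  qed
  then show ?case
    using rank_pivot[of A r c] Cons.prems(1) by (auto simp: p)
qed simp

text \<open>The Schur complement of the block on \<open>{x, y}\<close>, written without division for an edge whose two
  entries are inverse to each other and whose ends carry no loop: the entry at \<open>(i, j)\<close> loses the
  products along the walks \<open>i, y, x, j\<close> and \<open>i, x, y, j\<close>.\<close>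

definition edge_pivot :: "'n \<Rightarrow> 'n \<Rightarrow> 'a::field ^ 'n ^ 'n \<Rightarrow> 'a ^ 'n ^ 'n" where
  "edge_pivot x y A =
     (\<chi> i j. A $ i $ j - A $ i $ y * A $ y $ x * A $ x $ j - A $ i $ x * A $ x $ y * A $ y $ j)"

lemma rank_edge_pivot:
  fixes A :: "'a::field ^ 'n ^ 'n"
  assumes "A $ x $ x = 0" "A $ y $ y = 0" and inv: "A $ x $ y * A $ y $ x = 1"
  shows "rank A = rank (edge_pivot x y A) + 2"
proof -
  have nz: "A $ x $ y \<noteq> 0" "A $ y $ x \<noteq> 0"
    using inv by auto
  have inverses: "inverse (A $ x $ y) = A $ y $ x" "inverse (A $ y $ x) = A $ x $ y"
    using inv by (auto intro: inverse_unique simp: mult.commute)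
  have "pivot y x (pivot x y A) = edge_pivot x y A"
    using assms by (simp add: vec_eq_iff pivot_def edge_pivot_def divide_inverse inverses)
  moreover have "pivot x y A $ y $ x \<noteq> 0"
    using assms nz by (simp add: pivot_def)
  ultimately show ?thesis
    using rank_pivot[OF nz(1)] rank_pivot[of "pivot x y A" y x] by simp
qed

text \<open>Since \<open>x\<close> is adjacent to neither \<open>u\<close> nor \<open>v\<close>, the first elimination leaves the block on \<open>{u, v}\<close>
  unchanged, so this edge can be eliminated in turn.\<close>

lemma rank_two_edge_pivots:
  fixes A :: "'a::field ^ 'n ^ 'n"
  assumes "A $ x $ x = 0" "A $ y $ y = 0" "A $ u $ u = 0" "A $ v $ v = 0"
    and "A $ x $ u = 0" "A $ u $ x = 0" "A $ x $ v = 0" "A $ v $ x = 0"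
    and "A $ x $ y * A $ y $ x = 1" "A $ u $ v * A $ v $ u = 1"
  shows "rank A = rank (edge_pivot u v (edge_pivot x y A)) + 4"
proof -
  have "rank (edge_pivot x y A) = rank (edge_pivot u v (edge_pivot x y A)) + 2"
    by (rule rank_edge_pivot) (use assms in \<open>simp_all add: edge_pivot_def\<close>)
  then show ?thesis
    using rank_edge_pivot[of A x y] assms by simp
qed

section \<open>Graphs without pendant vertices\<close>

definition nbrs :: "'v pair_pre_digraph \<Rightarrow> 'v \<Rightarrow> 'v set" where
  "nbrs G v = {w. (v, w) \<in> parcs G}"

locale spanning_gain_graph = gain_graph G \<phi>
  for G :: "'v::finite pair_pre_digraph" and \<phi> :: "'v \<times> 'v \<Rightarrow> complex" +
  assumes pverts_UNIV: "pverts G = UNIV"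
begin

abbreviation "N \<equiv> nbrs G"
abbreviation "A \<equiv> adjacency_matrix G \<phi>"

lemma nbrs_sym: "w \<in> N v \<Longrightarrow> v \<in> N w"
  by (auto simp: nbrs_def intro: arcs_symmetric)

lemma nbrs_irrefl: "v \<notin> N v"
  using pair_no_loops[of "(v, v)"] by (auto simp: nbrs_def)

lemma A_eq_0_iff: "A $ i $ j = 0 \<longleftrightarrow> j \<notin> N i"
  using gain_unit[of "(i, j)"] by (auto simp: adjacency_matrix_def nbrs_def)

lemma out_degree_eq: "out_degree (with_proj G) v = card (N v)"
proof -
  have "out_arcs G v = Pair v ` N v"
    by (auto simp: out_arcs_def nbrs_def)
  then show ?thesis
    by (simp add: out_degree_def card_image inj_on_def)
qed

text \<open>The handshake lemma, for a graph given by its arcs: every edge comes from exactly two arcs.\<close>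

lemma sum_degrees: "(\<Sum>v\<in>UNIV. card (N v)) = 2 * card (edges G)"
proof -
  have "(\<Sum>v\<in>UNIV. card (N v)) = card (SIGMA v:UNIV. N v)"
    by simp
  also have "(SIGMA v:UNIV. N v) = parcs G"
    by (auto simp: nbrs_def)
  also have "card (parcs G) = (\<Sum>e\<in>edges G. card {a \<in> parcs G. (\<lambda>(u, v). {u, v}) a = e})"
    unfolding card_eq_sum edges_def by (rule sum.image_gen) simp
  also have "\<dots> = (\<Sum>e\<in>edges G. 2)"
  proof (rule sum.cong)
    fix e assume "e \<in> edges G"
    then obtain u v where uv: "(u, v) \<in> parcs G" and e: "e = {u, v}"
      by (auto simp: edges_def)
    then have "{a \<in> parcs G. (\<lambda>(u, v). {u, v}) a = e} = {(u, v), (v, u)}"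
      using arcs_symmetric by (auto simp: doubleton_eq_iff)
    moreover have "u \<noteq> v"
      using pair_no_loops[OF uv] by simp
    ultimately show "card {a \<in> parcs G. (\<lambda>(u, v). {u, v}) a = e} = 2"
      by simp
  qed simp
  finally show ?thesis
    by simp
qed

lemma closed_set_eq_UNIV:
  assumes conn: "Digraph_Component.connected (with_proj G)"
    and s: "s \<in> S" and closed: "\<And>v. v \<in> S \<Longrightarrow> N v \<subseteq> S"
  shows "S = UNIV"
proof -
  have "v \<in> S" for v
  proof -
    have "s \<rightarrow>\<^sup>*\<^bsub>mk_symmetric G\<^esub> v"
      using conn by (auto simp: connected_def strongly_connected_def pverts_UNIV)
    then have "s \<rightarrow>\<^sup>*\<^bsub>with_proj G\<^esub> v"
      using reachable_mk_symmetric_eq[OF pair_sym_arcs] by simp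
    then have "(s, v) \<in> rtrancl_on UNIV (parcs G)"
      by (simp add: reachable_def pverts_UNIV)
    then show ?thesis
      using s closed by induction (auto simp: nbrs_def)
  qed
  then show ?thesis
    by auto
qed

end

locale bicyclic_gain_graph = spanning_gain_graph +
  assumes bicyclic_G: "bicyclic G"
    and no_pendant: "\<nexists>v. pendant_vertex G v"
begin

lemma closed_set: "s \<in> S \<Longrightarrow> (\<And>v. v \<in> S \<Longrightarrow> N v \<subseteq> S) \<Longrightarrow> S = UNIV"
  using closed_set_eq_UNIV bicyclic_G unfolding bicyclic_def by blast

lemma degree_ge_2: "card (N v) \<ge> 2"
proof -
  have "card (N v) \<noteq> 0"
  proof
    assume "card (N v) = 0"
    then have empty: "N v = {}"
      by simp
    then have UNIV_eq: "{v} = UNIV"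
      by (intro closed_set) auto
    then have "parcs G = {}"
      using empty by (auto simp: nbrs_def)
    then have "card (edges G) = 0"
      by (simp add: edges_def)
    then show False
      using bicyclic_G by (simp add: bicyclic_def)
  qed
  moreover have "card (N v) \<noteq> 1"
    using no_pendant by (auto simp: pendant_vertex_def pverts_UNIV out_degree_eq)
  ultimately show ?thesis
    by linarith
qed

text \<open>By the handshake lemma the excesses of the degrees over 2 add up to
  \<open>2 * card E - 2 * card V = 2\<close>.\<close>

lemma branch_vertices:
  obtains (one) c where "card (N c) = 4" "\<And>w. w \<noteq> c \<Longrightarrow> card (N w) = 2"
  | (two) u v where "u \<noteq> v" "card (N u) = 3" "card (N v) = 3"
      "\<And>w. w \<noteq> u \<Longrightarrow> w \<noteq> v \<Longrightarrow> card (N w) = 2"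
proof -
  define f where "f v = card (N v) - 2" for v
  have deg: "card (N v) = f v + 2" for v
    using degree_ge_2[of v] by (simp add: f_def)
  have "(\<Sum>v\<in>UNIV. card (N v)) = sum f UNIV + 2 * CARD('a)"
    unfolding deg sum.distrib by simp
  moreover have "card (edges G) = CARD('a) + 1"
    using bicyclic_G by (simp add: bicyclic_def pverts_UNIV)
  ultimately have sum_f: "sum f UNIV = 2"
    using sum_degrees by simp
  then obtain u where "f u \<noteq> 0"
    by (metis sum.neutral zero_neq_numeral)
  have split: "sum f UNIV = f u + sum f (UNIV - {u})"
    by (rule sum.remove) auto
  show thesis
  proof (cases "f u = 1")
    case True
    then have "sum f (UNIV - {u}) = 1"
      using split sum_f by simp
    then obtain v where "v \<noteq> u" "f v = 1" "\<forall>w\<in>UNIV - {u}. v \<noteq> w \<longrightarrow> f w = 0"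
      by (subst (asm) sum_eq_1_iff) auto
    then show thesis
      using True by (intro two[of u v]) (auto simp: deg)
  next
    case False
    then have fu: "f u = 2" and rest: "sum f (UNIV - {u}) = 0"
      using split sum_f \<open>f u \<noteq> 0\<close> by linarith+
    then have "\<forall>w\<in>UNIV - {u}. f w = 0"
      by simp
    with fu show thesis
      by (intro one[of u]) (auto simp: deg)
  qed
qed

text \<open>The rows \<open>x1, x2, x3, y3, y2\<close> and the columns \<open>y1, y2, y3, x3, x2\<close> form a triangular pattern of
  size five.\<close>

lemma no_triangular_edge_triple:
  assumes "rank A \<le> 4"
    and "y1 \<in> N x1" "y2 \<in> N x2" "y3 \<in> N x3"
    and "x2 \<notin> N x1" "y2 \<notin> N x1" "x3 \<notin> N x1" "y3 \<notin> N x1" "x3 \<notin> N x2" "y3 \<notin> N x2"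
  shows False
proof -
  have "length [(x1, y1), (x2, y2), (x3, y3), (y3, x3), (y2, x2)] \<le> rank A"
    by (rule rank_ge_triangular)
      (use assms nbrs_sym nbrs_irrefl in \<open>auto simp: A_eq_0_iff\<close>)
  then show False
    using assms(1) by simp
qed

end

section \<open>Graphs that admit a gain matrix of rank at most four\<close>

locale low_rank_bicyclic_gain_graph = bicyclic_gain_graph +
  assumes rank_le_4: "rank A \<le> 4"
begin

text \<open>Otherwise \<open>w\<close> with any of its neighbours, then \<open>x1 y1\<close>, then \<open>x2 y2\<close> would be three edges as in
  \<open>no_triangular_edge_triple\<close>. This is the tool for the classification: two suitable edges have all
  vertices in their neighbourhood, and almost all vertices have degree 2, so few vertices can exist.\<close>

lemma domination:
  assumes "y1 \<in> N x1" "y2 \<in> N x2" "x2 \<notin> N x1" "y2 \<notin> N x1"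
  shows "w \<in> N x1 \<union> N y1 \<union> N x2 \<union> N y2"
proof (rule ccontr)
  assume not: "w \<notin> N x1 \<union> N y1 \<union> N x2 \<union> N y2"
  obtain z where "z \<in> N w"
    using degree_ge_2[of w] by fastforce
  then show False
    using no_triangular_edge_triple[OF rank_le_4, of z w y1 x1 y2 x2] assms not nbrs_sym by blast
qed

lemma nbrs_pairI: "card (N x) = 2 \<Longrightarrow> p \<in> N x \<Longrightarrow> q \<in> N x \<Longrightarrow> p \<noteq> q \<Longrightarrow> N x = {p, q}"
  by (auto simp: card_2_iff)

lemma other_nbr:
  assumes "card (N x) = 2" "p \<in> N x"
  obtains q where "N x = {p, q}" "q \<noteq> p" "q \<noteq> x" "x \<in> N q"
proof -
  obtain q where "N x = {p, q}" "q \<noteq> p"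
    using assms unfolding card_2_iff by (metis insert_commute insert_iff singletonD)
  moreover from calculation have "x \<in> N q"
    using nbrs_sym by blast
  ultimately show thesis
    using that nbrs_irrefl[of x] by auto
qed

lemma other_two_nbrs:
  assumes "card (N x) = 3" "p \<in> N x"
  obtains q r where "N x = {p, q, r}" "q \<noteq> p" "r \<noteq> p" "q \<noteq> r" "x \<in> N q" "x \<in> N r" "q \<noteq> x" "r \<noteq> x"
proof -
  have "card (N x - {p}) = 2"
    using assms by simp
  then obtain q r where "N x - {p} = {q, r}" "q \<noteq> r"
    by (auto simp: card_2_iff)
  then show thesis
    using that[of q r] assms(2) nbrs_sym[of _ x] nbrs_irrefl[of x] by blast
qed

text \<open>Recognises a labelled graph from a list of some vertices and their neighbourhoods: by
  connectedness a list that is closed under taking neighbours contains every vertex. The arcs are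
  compared by two inclusions, which for concrete graphs simplify to membership tests.\<close>

lemma labelling_listI:
  assumes "xs \<noteq> []" "distinct xs" "length xs = k" "\<forall>v\<in>set xs. N v \<subseteq> set xs"
    and arcs: "(\<Union>v\<in>set xs. Pair v ` N v) \<subseteq>
        (\<lambda>(i, j). (xs ! (i - 1), xs ! (j - 1))) ` E \<union> (\<lambda>(i, j). (xs ! (j - 1), xs ! (i - 1))) ` E"
      "(\<lambda>(i, j). (xs ! (i - 1), xs ! (j - 1))) ` E \<union> (\<lambda>(i, j). (xs ! (j - 1), xs ! (i - 1))) ` E
        \<subseteq> (\<Union>v\<in>set xs. Pair v ` N v)"
  shows "\<exists>l. labelling (labelled_graph k E) G l"
proof
  let ?l = "\<lambda>i. xs ! (i - 1)"
  have UNIV: "set xs = UNIV"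
    using assms by (intro closed_set[of "hd xs"]) auto
  have "bij_betw (\<lambda>i. i - 1) {1..k} {..<k}"
    by (rule bij_betw_byWitness[where f' = Suc]) auto
  moreover have "bij_betw ((!) xs) {..<k} UNIV"
    using assms UNIV by (metis bij_betw_nth)
  ultimately have "bij_betw ((!) xs \<circ> (\<lambda>i. i - 1)) {1..k} UNIV"
    by (rule bij_betw_trans)
  moreover have "parcs G = (\<Union>v\<in>UNIV. Pair v ` N v)"
    by (auto simp: nbrs_def)
  then have "parcs G = map_prod ?l ?l ` (E \<union> E\<inverse>)"
    using equalityI[OF arcs] by (force simp: UNIV image_Un)
  ultimately show "labelling (labelled_graph k E) G ?l"
    by (simp add: labelling_def labelled_graph_def pverts_UNIV comp_def)
qed

text \<open>Without \<open>c\<close> the graph consists of two paths whose ends are the four neighbours of \<open>c\<close>. A path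
  with two vertices closes to a triangle through \<open>c\<close>, one with three vertices to a four-cycle, and
  domination leaves no room for longer ones.\<close>

lemma one_branch_vertex:
  assumes c4: "card (N c) = 4" and deg2: "\<And>w. w \<noteq> c \<Longrightarrow> card (N w) = 2"
  shows "(\<exists>l. labelling G1 G l) \<or> (\<exists>l. labelling G2 G l) \<or> (\<exists>l. labelling G3 G l)"
proof -
  (* Some triangle passes through c. *)
  have tri: ?thesis if Nc: "N c = {a1, a2, a3, a4}" and dist: "distinct [a1, a2, a3, a4]"
    and a12: "a2 \<in> N a1" for a1 a2 a3 a4
  proof -
    have c: "c \<noteq> a1" "c \<noteq> a2" "c \<noteq> a3" "c \<noteq> a4"
      using Nc nbrs_irrefl[of c] by auto
    have ac: "c \<in> N a1" "c \<in> N a2" "c \<in> N a3" "c \<in> N a4"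
      using Nc nbrs_sym by auto
    have N1: "N a1 = {c, a2}"
      using c ac a12 deg2 by (intro nbrs_pairI) auto
    have N2: "N a2 = {c, a1}"
      using c ac nbrs_sym[OF a12] deg2 by (intro nbrs_pairI) auto
    obtain b where b: "N a3 = {c, b}" "b \<noteq> c" "b \<noteq> a3" "a3 \<in> N b"
      using other_nbr[OF _ ac(3)] deg2 c by metis
    show ?thesis
    proof (cases "b = a4")
      case True
      have N4: "N a4 = {c, a3}"
        using True b c ac deg2 by (intro nbrs_pairI) auto
      have "\<exists>l. labelling G1 G l"
        unfolding G1_def
        by (rule labelling_listI[of "[a1, a2, a3, a4, c]"]) (use c dist Nc N1 N2 N4 b True in auto)
      then show ?thesis
        by simp
    next
      case False
      have b': "b \<noteq> a1" "b \<noteq> a2"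
        using b(4) N1 N2 dist c by auto
      have "a4 \<in> N a1 \<union> N a2 \<union> N a3 \<union> N b"
        by (rule domination) (use a12 b b' dist c N1 in auto)
      then have a4: "a4 \<in> N b"
        using N1 N2 b dist c False by auto
      then have Nb: "N b = {a3, a4}"
        using b deg2 dist by (intro nbrs_pairI) auto
      have N4: "N a4 = {c, b}"
        using a4 b c ac deg2 by (intro nbrs_pairI) (auto intro: nbrs_sym)
      have "\<exists>l. labelling G2 G l"
        unfolding G2_def
        by (rule labelling_listI[of "[a1, a2, c, a3, b, a4]"])
          (use c dist Nc N1 N2 N4 Nb b b' False in auto)
      then show ?thesis
        by simp
    qed
  qed
  (* The neighbours of c have their other neighbours pairwise in common. *)
  have sq: ?thesis if Nc: "N c = {a1, a2, a3, a4}" and dist: "distinct [a1, a2, a3, a4]"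
    and N1: "N a1 = {c, b}" and N2: "N a2 = {c, b}" and N3: "N a3 = {c, d}" and N4: "N a4 = {c, d}"
    and bd: "b \<noteq> c" "d \<noteq> c"
    for a1 a2 a3 a4 b d
  proof -
    have c: "c \<noteq> a1" "c \<noteq> a2" "c \<noteq> a3" "c \<noteq> a4"
      using Nc nbrs_irrefl[of c] by auto
    have Nb: "N b = {a1, a2}"
      using bd N1 N2 deg2 dist nbrs_sym[of b] by (intro nbrs_pairI) auto
    have Nd: "N d = {a3, a4}"
      using bd N3 N4 deg2 dist nbrs_sym[of d] by (intro nbrs_pairI) auto
    have dist': "distinct [b, a1, a2, c, a3, d, a4]"
      using N1 N2 N3 N4 Nb Nd c dist bd by auto
    have "\<exists>l. labelling G3 G l"
      unfolding G3_def
      by (rule labelling_listI[of "[b, a1, a2, c, a3, d, a4]"])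
        (use dist' Nc N1 N2 N3 N4 Nb Nd in auto)
    then show ?thesis
      by simp
  qed
  show ?thesis
  proof (cases "\<exists>x\<in>N c. \<exists>y\<in>N c. y \<in> N x")
    case True
    then obtain x y where xy: "x \<in> N c" "y \<in> N c" "y \<in> N x"
      by auto
    then have "x \<noteq> y"
      using nbrs_irrefl by auto
    then have "card (N c - {x, y}) = 2"
      using c4 xy by (simp add: card_Diff_subset)
    then obtain a3 a4 where a: "N c - {x, y} = {a3, a4}" "a3 \<noteq> a4"
      by (auto simp: card_2_iff)
    have "N c = {x, y, a3, a4}" "distinct [x, y, a3, a4]"
      using a xy \<open>x \<noteq> y\<close> by auto
    then show ?thesis
      using tri xy by blast
  next
    case False
    obtain a1 a2 a3 a4 where Nc: "N c = {a1, a2, a3, a4}" and dist: "distinct [a1, a2, a3, a4]"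
      using c4 by (auto simp: card_Suc_eq eval_nat_numeral)
    have c: "c \<noteq> a1" "c \<noteq> a2" "c \<noteq> a3" "c \<noteq> a4"
      using Nc nbrs_irrefl[of c] by auto
    have ac: "c \<in> N a1" "c \<in> N a2" "c \<in> N a3" "c \<in> N a4"
      using Nc nbrs_sym by auto
    obtain b1 where b1: "N a1 = {c, b1}" "b1 \<noteq> c" "b1 \<noteq> a1" "a1 \<in> N b1"
      using other_nbr[OF _ ac(1)] deg2 c by metis
    obtain b2 where b2: "N a2 = {c, b2}" "b2 \<noteq> c" "b2 \<noteq> a2" "a2 \<in> N b2"
      using other_nbr[OF _ ac(2)] deg2 c by metis
    obtain b3 where b3: "N a3 = {c, b3}" "b3 \<noteq> c" "b3 \<noteq> a3" "a3 \<in> N b3"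
      using other_nbr[OF _ ac(3)] deg2 c by metis
    obtain b4 where b4: "N a4 = {c, b4}" "b4 \<noteq> c" "b4 \<noteq> a4" "a4 \<in> N b4"
      using other_nbr[OF _ ac(4)] deg2 c by metis
    have outer: "b1 \<notin> N c" "b2 \<notin> N c" "b3 \<notin> N c" "b4 \<notin> N c"
      using False Nc b1(1) b2(1) b3(1) b4(1) by auto
    show ?thesis
    proof (cases "b1 = b2")
      case True
      have Nb: "N b1 = {a1, a2}"
        using True b1 b2 deg2 dist by (intro nbrs_pairI) auto
      have "a4 \<in> N a1 \<union> N b1 \<union> N a3 \<union> N b3"
        by (rule domination) (use b1 b3 Nb dist c outer Nc in auto)
      then have "a4 \<in> N b3"
        using b1 Nb b3 dist c outer Nc by auto
      then have "b4 = b3"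
        using nbrs_sym[of a4 b3] b4 b3 by auto
      then show ?thesis
        using sq[of a1 a2 a3 a4 b1 b3] Nc dist b1 b2 b3 b4 True by auto
    next
      case b12: False
      have dom: "w \<in> N a1 \<union> N b1 \<union> N a2 \<union> N b2" for w
        by (rule domination) (use b1 b2 b12 dist c outer Nc in auto)
      have a3: "a3 \<in> N b1 \<or> a3 \<in> N b2" and a4: "a4 \<in> N b1 \<or> a4 \<in> N b2"
        using dom[of a3] dom[of a4] b1 b2 c outer Nc by auto
      have full: "\<not> (a3 \<in> N b1 \<and> a4 \<in> N b1)" "\<not> (a3 \<in> N b2 \<and> a4 \<in> N b2)"
        using nbrs_pairI[of b1 a1 a3] nbrs_pairI[of b2 a2 a3] deg2 b1 b2 dist by auto
      have eq: "x \<in> N y \<Longrightarrow> y \<in> N x" for x y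
        by (rule nbrs_sym)
      from a3 show ?thesis
      proof
        assume *: "a3 \<in> N b1"
        then have "b3 = b1" "b4 = b2"
          using a4 full b3 b4 b1 b2 eq[of a3 b1] eq[of a4 b2] by auto
        then show ?thesis
          using sq[of a1 a3 a2 a4 b1 b2] Nc dist b1 b2 b3 b4 by auto
      next
        assume *: "a3 \<in> N b2"
        then have "b3 = b2" "b4 = b1"
          using a4 full b3 b4 b1 b2 eq[of a3 b2] eq[of a4 b1] by auto
        then show ?thesis
          using sq[of a1 a4 a2 a3 b1 b2] Nc dist b1 b2 b3 b4 by auto
      qed
    qed
  qed
qed
text \<open>The criterion with three edges does not apply here, since the rank can be exactly five. The rows
  \<open>p, q, u, s, t\<close> and the columns \<open>q, p, v, t, s\<close> still form a triangular pattern: the edge \<open>u v\<close>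
  enters by one of its two arcs only.\<close>

lemma no_two_linked_triangles:
  assumes "N p = {u, q}" "N q = {u, p}" "N s = {v, t}" "N t = {v, s}" "N u = {v, p, q}"
    and "distinct [p, q, s, t, u, v]"
  shows False
proof -
  have "length [(p, q), (q, p), (u, v), (s, t), (t, s)] \<le> rank A"
    by (rule rank_ge_triangular) (use assms in \<open>auto simp: A_eq_0_iff\<close>)
  then show False
    using rank_le_4 by simp
qed

text \<open>Let \<open>p, q\<close> and \<open>s, t\<close> be the further neighbours of \<open>u\<close> and of \<open>v\<close>. If these pairs meet, the graph
  is a theta graph with a path of length 1 and one of length 2 between \<open>u\<close> and \<open>v\<close>, and domination
  bounds the length of the third path. If they are disjoint, three edges as in \<open>no_triangular_edge_triple\<close> are
  found unless the graph consists of two triangles linked by \<open>u v\<close>, which is excluded separately, or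
  of two four-cycles that share the edge \<open>u v\<close>.\<close>

lemma adjacent_branch_vertices:
  assumes u3: "card (N u) = 3" and v3: "card (N v) = 3" and uv: "v \<in> N u"
    and deg2: "\<And>w. w \<noteq> u \<Longrightarrow> w \<noteq> v \<Longrightarrow> card (N w) = 2"
  shows "(\<exists>l. labelling G5 G l) \<or> (\<exists>l. labelling G6 G l) \<or> (\<exists>l. labelling G7 G l)
    \<or> (\<exists>l. labelling G8 G l)"
proof -
  obtain p q where Nu: "N u = {v, p, q}" and pq: "p \<noteq> v" "q \<noteq> v" "p \<noteq> q" "p \<noteq> u" "q \<noteq> u"
    and upq: "u \<in> N p" "u \<in> N q"
    using other_two_nbrs[OF u3 uv] by metis
  obtain s t where Nv: "N v = {u, s, t}" and st: "s \<noteq> v" "t \<noteq> v" "s \<noteq> t" "s \<noteq> u" "t \<noteq> u"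
    and vst: "v \<in> N s" "v \<in> N t"
    using other_two_nbrs[OF v3 nbrs_sym[OF uv]] by metis
  have vu: "v \<noteq> u"
    using uv nbrs_irrefl by auto
  have both: ?thesis if "N u = {v, p, q}" "N v = {u, p, q}" "distinct [u, v, p, q]" for p q
  proof -
    have Np: "N p = {u, v}"
      using that deg2 nbrs_sym[of p] by (intro nbrs_pairI) auto
    have Nq: "N q = {u, v}"
      using that deg2 nbrs_sym[of q] by (intro nbrs_pairI) auto
    have "distinct [p, u, v, q]"
      using that by auto
    then have "\<exists>l. labelling G5 G l"
      unfolding G5_def
      by (intro labelling_listI[of "[p, u, v, q]"]) (simp_all add: that(1,2) Np Nq)
    then show ?thesis
      by simp
  qed
  have common: ?thesis if Nu: "N u = {v, p, q}" and Nv: "N v = {u, p, t}"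
    and dist: "distinct [u, v, p, q, t]" for p q t
  proof -
    have Np: "N p = {u, v}"
      using Nu Nv dist deg2 nbrs_sym[of p] by (intro nbrs_pairI) auto
    have "u \<in> N q" "v \<in> N t"
      using Nu Nv by (auto intro: nbrs_sym)
    moreover have "card (N q) = 2" "card (N t) = 2"
      using deg2 dist by auto
    ultimately obtain q' t' where q': "N q = {u, q'}" "q' \<noteq> u" "q' \<noteq> q" "q \<in> N q'"
      and t': "N t = {v, t'}" "t' \<noteq> v" "t' \<noteq> t" "t \<in> N t'"
      using other_nbr by metis
    have out: "q' \<noteq> v" "t' \<noteq> u" "q' \<noteq> p" "t' \<noteq> p"
      using q'(4) t'(4) dist by (auto simp: Nu Nv Np)
    show ?thesis
    proof (cases "q' = t")
      case True
      then have Nt: "N t = {v, q}"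
        using q' \<open>v \<in> N t\<close> deg2 dist by (intro nbrs_pairI) auto
      have "distinct [p, u, q, t, v]"
        using dist by auto
      then have "\<exists>l. labelling G6 G l"
        unfolding G6_def
        by (intro labelling_listI[of "[p, u, q, t, v]"]) (simp_all add: Nu Nv Np q'(1) Nt True)
      then show ?thesis
        by simp
    next
      case q't: False
      then have t'q: "t' \<noteq> q"
        using t' q' dist by auto
      have eq: "q' = t'"
      proof (rule ccontr)
        assume "q' \<noteq> t'"
        have "p \<in> N q \<union> N q' \<union> N t \<union> N t'"
          by (rule domination) (use q' t' out q't t'q \<open>q' \<noteq> t'\<close> dist in auto)
        then show False
          using nbrs_sym[of p q'] nbrs_sym[of p t'] Np q' t' out dist by auto
      qed
      have Nq': "N q' = {q, t}"
        using q' t' eq out deg2 dist by (intro nbrs_pairI) auto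
      have "distinct [p, u, q, q', t, v]"
        using dist q' out q't by auto
      then have "\<exists>l. labelling G7 G l"
        unfolding G7_def
        by (intro labelling_listI[of "[p, u, q, q', t, v]"])
          (simp_all add: Nu Nv Np q'(1) t'(1) Nq' eq[symmetric])
      then show ?thesis
        by simp
    qed
  qed
  show ?thesis
  proof (cases "{p, q} \<inter> {s, t} = {}")
    case False
    then consider "p = s" "q = t" | "p = t" "q = s" | "p = s" "q \<noteq> t" | "p = t" "q \<noteq> s"
      | "q = s" "p \<noteq> t" | "q = t" "p \<noteq> s"
      by auto
    then show ?thesis
    proof cases
      case 1
      then show ?thesis using both[of p q] Nu Nv pq vu by auto
    next
      case 2
      then show ?thesis using both[of p q] Nu Nv pq vu by (auto simp: insert_commute)
    next
      case 3
      then show ?thesis using common[of p q t] Nu Nv pq st vu by auto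
    next
      case 4
      then show ?thesis using common[of p q s] Nu Nv pq st vu by (auto simp: insert_commute)
    next
      case 5
      then show ?thesis using common[of q p t] Nu Nv pq st vu by (auto simp: insert_commute)
    next
      case 6
      then show ?thesis using common[of q p s] Nu Nv pq st vu by (auto simp: insert_commute)
    qed
  next
    case disjoint: True
    (* Stated for arbitrary vertices, since it is needed with the roles of u and v exchanged. *)
    have no_triangle: "q \<notin> N p"
      if Nu: "N u = {v, p, q}" and Nv: "N v = {u, s, t}" and dist: "distinct [u, v, p, q, s, t]"
        and deg2: "\<And>w. w \<noteq> u \<Longrightarrow> w \<noteq> v \<Longrightarrow> card (N w) = 2"
      for u v p q s t
    proof
      assume qp: "q \<in> N p"
      have Np: "N p = {u, q}"
        using Nu qp dist deg2 nbrs_sym[of p] by (intro nbrs_pairI) auto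
      have Nq: "N q = {u, p}"
        using Nu nbrs_sym[OF qp] dist deg2 nbrs_sym[of q] by (intro nbrs_pairI) auto
      have "v \<in> N s" "v \<in> N t"
        using Nv by (auto intro: nbrs_sym)
      moreover have "card (N s) = 2"
        using deg2 dist by auto
      ultimately obtain x where x: "N s = {v, x}" "x \<noteq> v" "x \<noteq> s" "s \<in> N x"
        using other_nbr by metis
      show False
      proof (cases "x = t")
        case True
        then have "N t = {v, s}"
          using x \<open>v \<in> N t\<close> deg2 dist by (intro nbrs_pairI) auto
        then show False
          using no_two_linked_triangles[of p u q s v t] Np Nq x True Nu dist by auto
      next
        case False
        then have out: "x \<noteq> u" "x \<noteq> p" "x \<noteq> q"
          using x Nu Np Nq dist by auto
        then have "x \<notin> N u" "x \<notin> N v" "x \<notin> N p" "x \<notin> N q"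
          using x False dist by (auto simp: Np Nq Nu Nv)
        then have "u \<notin> N x" "v \<notin> N x" "p \<notin> N x" "q \<notin> N x"
          using nbrs_sym by blast+
        moreover have "u \<in> N v" "p \<notin> N v" "q \<notin> N v"
          using Nv dist by auto
        ultimately show False
          using no_triangular_edge_triple[OF rank_le_4, of s x u v q p] x(4) qp by blast
      qed
    qed
    have dist: "distinct [u, v, p, q, s, t]"
      using pq st vu disjoint by auto
    have qp: "q \<notin> N p" and ts: "t \<notin> N s"
      using no_triangle[OF Nu Nv dist deg2] no_triangle[OF Nv Nu _ deg2, of ] dist by auto
    (* A path u, p, s, v of length 3: the remaining neighbours q and t must then be adjacent. *)
    have cross: ?thesis
      if Nu: "N u = {v, p, q}" and Nv: "N v = {u, s, t}" and dist: "distinct [u, v, p, q, s, t]"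
        and qp: "q \<notin> N p" and ts: "t \<notin> N s" and ps: "s \<in> N p"
      for p q s t
    proof -
      have up: "u \<in> N p" "u \<in> N q" and vs: "v \<in> N s" "v \<in> N t"
        using Nu Nv by (auto intro: nbrs_sym)
      have Np: "N p = {u, s}"
        using up ps dist deg2 by (intro nbrs_pairI) auto
      have Ns: "N s = {v, p}"
        using vs nbrs_sym[OF ps] dist deg2 by (intro nbrs_pairI) auto
      have "card (N q) = 2"
        using deg2 dist by auto
      then obtain q' where q': "N q = {u, q'}" "q' \<noteq> u" "q' \<noteq> q" "q \<in> N q'"
        using other_nbr up(2) by metis
      have out: "q' \<noteq> p" "q' \<noteq> s" "q' \<noteq> v"
        using q'(4) dist by (auto simp: Np Ns Nv)
      have "q' = t"
      proof (rule ccontr)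
        assume "q' \<noteq> t"
        show False
          by (rule no_triangular_edge_triple[OF rank_le_4, of q' q s p v t])
            (use q' out \<open>q' \<noteq> t\<close> Np vs dist in auto)
      qed
      then have Nt: "N t = {v, q}"
        using q' vs dist deg2 by (intro nbrs_pairI) auto
      have "distinct [p, u, q, t, v, s]"
        using dist by auto
      then have "\<exists>l. labelling G8 G l"
        unfolding G8_def
        by (intro labelling_listI[of "[p, u, q, t, v, s]"])
          (simp_all add: Nu Nv Np Ns Nt q'(1) \<open>q' = t\<close>)
      then show ?thesis
        by simp
    qed
    have Nu': "N u = {v, q, p}" and Nv': "N v = {u, t, s}"
      using Nu Nv by auto
    have pq': "p \<notin> N q" and st': "s \<notin> N t"
      using qp ts nbrs_sym by auto
    consider "s \<in> N p" | "t \<in> N p" | "s \<in> N q" | "t \<in> N q"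
      | "s \<notin> N p" "t \<notin> N p" "s \<notin> N q" "t \<notin> N q"
      by auto
    then show ?thesis
    proof cases
      case 1
      then show ?thesis using cross[OF Nu Nv dist qp ts] by auto
    next
      case 2
      then show ?thesis using cross[OF Nu Nv' _ qp st'] dist by auto
    next
      case 3
      then show ?thesis using cross[OF Nu' Nv _ pq' ts] dist by auto
    next
      case 4
      then show ?thesis using cross[OF Nu' Nv' _ pq' st'] dist by auto
    next
      case none: 5
      obtain p' where p': "N p = {u, p'}" "p' \<noteq> u" "p' \<noteq> p" "p \<in> N p'"
        using other_nbr[OF _ upq(1)] deg2 pq by metis
      obtain q' where q': "N q = {u, q'}" "q' \<noteq> u" "q' \<noteq> q" "q \<in> N q'"
        using other_nbr[OF _ upq(2)] deg2 pq by metis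
      obtain s' where s': "N s = {v, s'}" "s' \<noteq> v" "s' \<noteq> s" "s \<in> N s'"
        using other_nbr[OF _ vst(1)] deg2 st by metis
      have pv: "p \<notin> N v" "q \<notin> N v" and su: "s \<notin> N u" "t \<notin> N u"
        using Nu Nv dist by auto
      have none': "p \<notin> N s" "p \<notin> N t" "q \<notin> N s" "q \<notin> N t"
        using none nbrs_sym by blast+
      have "p' \<notin> N u" "p' \<notin> N v" "q' \<notin> N u" "q' \<notin> N v"
        using p'(2-4) q'(2-4) none' qp pq' pv by (auto simp: Nu Nv)
      moreover have "s' \<notin> N u" "s' \<notin> N v"
        using s'(2-4) none st' su by (auto simp: Nu Nv)
      ultimately have outer: "u \<notin> N p'" "v \<notin> N p'" "u \<notin> N q'" "v \<notin> N q'" "u \<notin> N s'" "v \<notin> N s'"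
        by (meson nbrs_sym)+
      have outer': "p' \<noteq> v" "q' \<noteq> v" "s' \<noteq> u"
        using p'(4) q'(4) s'(4) pv su by auto
      (* Otherwise x x', s s' and u v are three edges as in no_triangular_edge_triple. *)
      have far: "x' = s' \<or> s' \<in> N x'"
        if "N x = {u, x'}" "x \<in> N x'" "u \<notin> N x'" "v \<notin> N x'" "s \<notin> N x" for x x'
      proof (rule ccontr)
        assume not: "\<not> (x' = s' \<or> s' \<in> N x')"
        have "x' \<noteq> v"
          using that(3) nbrs_sym[OF uv] by auto
        then have "s \<notin> N x'"
          using not s'(1) nbrs_sym[of s x'] by auto
        then show False
          using no_triangular_edge_triple[OF rank_le_4, of x x' s s' v u] that(2-4) not s'(4) outer uv by blast
      qed
      have P: "p' = s' \<or> s' \<in> N p'" and Q: "q' = s' \<or> s' \<in> N q'"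
        using far[of p p'] far[of q q'] p' q' outer none by blast+
      have deg2': "card (N s') = 2" "card (N p') = 2"
        using outer' p' s' deg2 by auto
      (* Now s' would have to be close to s and to both p and q, which its degree 2 forbids. *)
      have False
        using P
      proof
        assume eq: "p' = s'"
        then have Ns': "N s' = {s, p}"
          using p'(4) s'(4) deg2' dist by (intro nbrs_pairI) auto
        show False
          using Q q'(4) none' qp dist nbrs_sym[of s' q'] by (auto simp: Ns')
      next
        assume adj: "s' \<in> N p'"
        then have Ns': "N s' = {s, p'}"
          using s'(4) deg2' nbrs_sym[OF adj] none' p'(4) by (intro nbrs_pairI) auto
        have Np': "N p' = {p, s'}"
          using adj p'(4) s'(4) deg2' none by (intro nbrs_pairI) auto
        then show False
          using Q q'(4) p'(4) s'(4) none none' pq' dist nbrs_sym[of s' q'] by (auto simp: Ns' Np')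
      qed
      then show ?thesis ..
    qed
  qed
qed

text \<open>A triangle at \<open>u\<close> has to be joined to the distant vertex \<open>v\<close> by a path that starts with the edge
  \<open>r r'\<close>. The edges \<open>p q\<close> and \<open>r r'\<close> then fail to dominate the part of the graph beyond \<open>v\<close>, unless
  \<open>r' = v\<close>, where an edge beyond \<open>v\<close> and \<open>p q\<close> fail to dominate \<open>r\<close>.\<close>

lemma nonadjacent_branch_vertices_triangle_free:
  assumes uv: "u \<noteq> v" "v \<notin> N u" and Nu: "N u = {p, q, r}" and dist: "distinct [u, p, q, r]"
    and v3: "card (N v) = 3"
    and deg2: "\<And>w. w \<noteq> u \<Longrightarrow> w \<noteq> v \<Longrightarrow> card (N w) = 2"
  shows "q \<notin> N p"
proof
  assume qp: "q \<in> N p"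
  have up: "u \<in> N p" "u \<in> N q" "u \<in> N r"
    using Nu by (auto intro: nbrs_sym)
  have v: "v \<noteq> p" "v \<noteq> q" "v \<noteq> r" "u \<notin> N v"
    using uv Nu nbrs_sym by auto
  have cards: "card (N p) = 2" "card (N q) = 2" "card (N r) = 2"
    using deg2 v dist by auto
  have Np: "N p = {u, q}"
    using up qp cards dist by (intro nbrs_pairI) auto
  have Nq: "N q = {u, p}"
    using up nbrs_sym[OF qp] cards dist by (intro nbrs_pairI) auto
  obtain r' where r': "N r = {u, r'}" "r' \<noteq> u" "r' \<noteq> r" "r \<in> N r'"
    using other_nbr cards(3) up(3) by metis
  have r'_out: "r' \<noteq> p" "r' \<noteq> q"
    using r'(4) dist by (auto simp: Np Nq)
  have dom: "w \<in> {u, p, q, r'} \<union> N r'" for w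
    using domination[of q p r' r w] qp dist r'(1,2) r'_out by (auto simp: Np Nq)
  show False
  proof (cases "r' = v")
    case True
    then have "r \<in> N v"
      using r'(4) by simp
    then obtain s t where s: "N v = {r, s, t}" "s \<noteq> r" "s \<noteq> v" "v \<in> N s"
      using other_two_nbrs v3 by metis
    have "s \<noteq> u" "s \<noteq> p" "s \<noteq> q"
      using s(4) uv v by (auto simp: Np Nq)
    then obtain s' where s': "N s = {v, s'}" "s' \<noteq> v" "s' \<noteq> s" "s \<in> N s'"
      using other_nbr s(3,4) deg2 by metis
    have "s' \<noteq> u" "s' \<noteq> q" "s' \<noteq> r"
      using s'(4) s(2,3) \<open>s \<noteq> u\<close> \<open>s \<noteq> p\<close> \<open>s \<noteq> q\<close> True by (auto simp: Nu Nq r'(1))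
    then have "r \<in> N p \<union> N q \<union> N s \<union> N s'"
      using s'(1) qp \<open>s \<noteq> u\<close> \<open>s \<noteq> q\<close> by (intro domination) (auto simp: Np)
    then have "r \<in> N s'"
      using \<open>s' \<noteq> r\<close> v dist by (auto simp: Np Nq s'(1))
    then show False
      using nbrs_sym[of r s'] \<open>s' \<noteq> u\<close> s'(2) True by (auto simp: r'(1))
  next
    case False
    then have "v \<in> N r'"
      using dom[of v] uv v by auto
    then have Nr': "N r' = {r, v}"
      using r'(2,4) False deg2 v by (intro nbrs_pairI) auto
    have "r' \<in> N v"
      using \<open>v \<in> N r'\<close> by (rule nbrs_sym)
    then obtain s t where s: "N v = {r', s, t}" "s \<noteq> r'" "s \<noteq> v" "v \<in> N s"
      using other_two_nbrs v3 by metis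
    have "s \<noteq> u" "s \<noteq> p" "s \<noteq> q" "s \<noteq> r"
      using s(4) uv v False by (auto simp: Np Nq r'(1))
    then show False
      using dom[of s] s(2,3) by (auto simp: Nr')
  qed
qed

text \<open>The argument counts the common neighbours of \<open>u\<close> and \<open>v\<close>. Having three of them leaves no further
  vertex; with two of them the graph is a theta graph with two paths of length 2, and domination
  bounds the third path; with one or none, two edges can be found that do not dominate.\<close>

lemma nonadjacent_branch_vertices:
  assumes uv: "u \<noteq> v" "v \<notin> N u" and u3: "card (N u) = 3" and v3: "card (N v) = 3"
    and deg2: "\<And>w. w \<noteq> u \<Longrightarrow> w \<noteq> v \<Longrightarrow> card (N w) = 2"
  shows "(\<exists>l. labelling G9 G l) \<or> (\<exists>l. labelling G10 G l) \<or> (\<exists>l. labelling G11 G l)"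
proof -
  have vu: "u \<notin> N v"
    using uv nbrs_sym by blast
  have deg2_nbr: "card (N w) = 2" if "w \<in> N u \<or> w \<in> N v" for w
    using that uv vu by (intro deg2) (auto simp: nbrs_irrefl)
  have indep: "y \<notin> N x" if "x \<in> N u" "y \<in> N u" for x y
  proof
    assume xy: "y \<in> N x"
    then have "x \<noteq> y" "x \<noteq> u" "y \<noteq> u"
      using that nbrs_irrefl by auto
    then have "card (N u - {x, y}) = 1"
      using u3 that by (simp add: card_Diff_subset)
    then obtain z where "N u - {x, y} = {z}"
      by (auto simp: card_1_singleton_iff)
    then have "N u = {x, y, z}" "distinct [u, x, y, z]"
      using that \<open>x \<noteq> y\<close> nbrs_irrefl[of u] by auto
    then show False
      using nonadjacent_branch_vertices_triangle_free[OF uv _ _ v3 deg2] xy by blast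
  qed
  have outer: "\<exists>q'. N q = {u, q'} \<and> q' \<noteq> u \<and> q' \<notin> N u \<and> q \<in> N q'" if "q \<in> N u" for q
  proof -
    have "card (N q) = 2" "u \<in> N q"
      using deg2_nbr that nbrs_sym by blast+
    then obtain q' where "N q = {u, q'}" "q' \<noteq> u" "q \<in> N q'"
      using other_nbr by metis
    then show ?thesis
      using indep[OF that] by auto
  qed
  (* The edges q q' and r r' dominate the third neighbour of u. *)
  have third: "p \<in> N q' \<or> p \<in> N r'"
    if "N u = {p, q, r}" "distinct [p, q, r]" "N q = {u, q'}" "N r = {u, r'}" "q' \<noteq> r'"
      "q' \<notin> N u" "r' \<notin> N u" "q' \<noteq> u" "r' \<noteq> u"
    for p q r q' r'
  proof -
    have "p \<in> N q \<union> N q' \<union> N r \<union> N r'"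
      using that nbrs_irrefl[of u] by (intro domination) auto
    moreover have "p \<noteq> u"
      using that(1) nbrs_irrefl[of u] by auto
    ultimately show ?thesis
      using that by auto
  qed
  have card_le: "card (N u \<inter> N v) \<le> 3"
    using card_mono[of "N u" "N u \<inter> N v"] u3 by simp
  then consider "card (N u \<inter> N v) = 0" | "card (N u \<inter> N v) = 1" | "card (N u \<inter> N v) = 2"
    | "card (N u \<inter> N v) = 3"
    by linarith
  then show ?thesis
  proof cases
    case 1
    then have disj: "N u \<inter> N v = {}"
      by simp
    have impossible: False
      if Nu: "N u = {p, q, r}" and dist: "distinct [p, q, r]"
        and Nq: "N q = {u, x}" and Nr: "N r = {u, y}" and xy: "x \<noteq> y" and px: "p \<in> N x"
        and x: "x \<noteq> u" "x \<notin> N u" and y: "y \<noteq> u" "y \<notin> N u"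
      for p q r x y
    proof -
      have qx: "q \<in> N x" and ry: "r \<in> N y"
        using Nq Nr by (auto intro: nbrs_sym)
      have not_v: "x \<noteq> v" "y \<noteq> v"
        using qx ry disj Nu by auto
      have Nx: "N x = {q, p}"
        using qx px dist x not_v deg2 by (intro nbrs_pairI) auto
      have dom: "w \<in> {u, x, q, p, y} \<union> N y" for w
        using domination[of x q y r w] dist xy x y nbrs_irrefl[of u] by (auto simp: Nq Nr Nx Nu)
      have "v \<in> N y"
        using dom[of v] uv not_v by (auto simp: Nu)
      then have Ny: "N y = {r, v}"
        using ry not_v y deg2 uv(2) Nu by (intro nbrs_pairI) auto
      obtain s t where s: "N v = {y, s, t}" "s \<noteq> y" "s \<noteq> v" "v \<in> N s"
        using other_two_nbrs[OF v3 nbrs_sym[OF \<open>v \<in> N y\<close>]] by metis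
      have "s \<notin> N u" "s \<noteq> u" "s \<noteq> x"
        using disj s(1,4) uv Nu by (auto simp: Nx)
      then show False
        using dom[of s] s(2,3) by (auto simp: Nu Ny)
    qed
    obtain p q r where Nu: "N u = {p, q, r}" and dist: "distinct [p, q, r]"
      using u3 by (auto simp: card_Suc_eq eval_nat_numeral)
    obtain p' q' r' where p': "N p = {u, p'}" "p' \<noteq> u" "p' \<notin> N u" "p \<in> N p'"
      and q': "N q = {u, q'}" "q' \<noteq> u" "q' \<notin> N u" "q \<in> N q'"
      and r': "N r = {u, r'}" "r' \<noteq> u" "r' \<notin> N u" "r \<in> N r'"
      using outer[of p] outer[of q] outer[of r] Nu by auto
    have "\<not> (p' = q' \<and> p' = r')"
    proof
      assume eq: "p' = q' \<and> p' = r'"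
      then have "{p, q, r} \<subseteq> N p'"
        using p'(4) q'(4) r'(4) by auto
      then have "card {p, q, r} \<le> card (N p')"
        by (intro card_mono) auto
      then have "p' = v"
        using dist p'(2) deg2[of p'] by auto
      then show False
        using p'(4) disj Nu by auto
    qed
    then consider "q' \<noteq> r'" | "p' \<noteq> r'" "p' \<noteq> q'"
      by auto
    then have False
    proof cases
      case 1
      then have "p \<in> N q' \<or> p \<in> N r'"
        using third[OF Nu dist q'(1) r'(1)] q'(2,3) r'(2,3) by simp
      then show False
      proof
        assume "p \<in> N q'"
        then show False
          using impossible[OF Nu dist q'(1) r'(1)] 1 q'(2,3) r'(2,3) by simp
      next
        assume "p \<in> N r'"
        then show False
          using impossible[of p r q r' q'] Nu dist 1 q'(1-3) r'(1-3) by (auto simp: insert_commute)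
      qed
    next
      case 2
      then have "q \<in> N p' \<or> q \<in> N r'"
        using third[of q p r p' r'] Nu dist p'(1-3) r'(1-3) by (auto simp: insert_commute)
      then show False
      proof
        assume "q \<in> N p'"
        then show False
          using impossible[of q p r p' r'] Nu dist 2 p'(1-3) r'(1-3) by (auto simp: insert_commute)
      next
        assume "q \<in> N r'"
        then show False
          using impossible[of q r p r' p'] Nu dist 2 p'(1-3) r'(1-3) by (auto simp: insert_commute)
      qed
    qed
    then show ?thesis ..
  next
    case 2
    then obtain p where inter: "N u \<inter> N v = {p}"
      by (auto simp: card_1_singleton_iff)
    then have pu: "p \<in> N u" and pv: "p \<in> N v"
      by auto
    obtain q r where Nu: "N u = {p, q, r}" and dist: "q \<noteq> p" "r \<noteq> p" "q \<noteq> r"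
      using other_two_nbrs[OF u3 pu] by metis
    obtain s t where s: "N v = {p, s, t}" "s \<noteq> p" "s \<noteq> v" "v \<in> N s"
      using other_two_nbrs[OF v3 pv] by metis
    have Np: "N p = {u, v}"
      using pu pv uv deg2_nbr by (intro nbrs_pairI) (auto intro: nbrs_sym)
    obtain q' r' where q': "N q = {u, q'}" "q' \<noteq> u" "q' \<notin> N u" "q \<in> N q'"
      and r': "N r = {u, r'}" "r' \<noteq> u" "r' \<notin> N u" "r \<in> N r'"
      using outer[of q] outer[of r] Nu by auto
    have not_v: "q' \<noteq> v" "r' \<noteq> v"
      using q'(4) r'(4) inter dist Nu by auto
    have eq: "q' = r'"
    proof (rule ccontr)
      assume "q' \<noteq> r'"
      then have "p \<in> N q' \<or> p \<in> N r'"
        using third[OF Nu _ q'(1) r'(1)] dist q'(2,3) r'(2,3) by simp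
      then show False
        using nbrs_sym[of p q'] nbrs_sym[of p r'] q'(2) r'(2) not_v by (auto simp: Np)
    qed
    have Nq': "N q' = {q, r}"
      using q'(2,4) r'(4) eq dist not_v deg2 by (intro nbrs_pairI) auto
    have s_out: "s \<notin> N u" "s \<noteq> u" "s \<noteq> q'"
      using inter s(1,2,4) vu uv(2) Nu by (auto simp: Nq')
    then obtain s' where s': "N s = {v, s'}" "s' \<noteq> v" "s' \<noteq> s" "s \<in> N s'"
      using other_nbr[OF deg2_nbr s(4)] s(1) by auto
    have s'_out: "s' \<noteq> u" "s' \<noteq> q'" "s' \<noteq> p"
      using s'(4) s_out s(3) by (auto simp: Nq' Nu Np)
    have "p \<in> N q \<union> N q' \<union> N s \<union> N s'"
      by (rule domination) (use s_out s'_out in \<open>auto simp: q'(1) s'(1)\<close>)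
    moreover have "p \<noteq> u" "p \<noteq> v" "p \<noteq> q'"
      using pu pv nbrs_irrefl[of u] nbrs_irrefl[of v] q'(3) by auto
    ultimately have "p \<in> N s'"
      using dist s'_out by (auto simp: q'(1) Nq' s'(1))
    then show ?thesis
      using nbrs_sym[of p s'] s'_out s'(2) by (auto simp: Np)
  next
    case 3
    then obtain p q where inter: "N u \<inter> N v = {p, q}" and pq: "p \<noteq> q"
      by (auto simp: card_2_iff)
    have "{p, q} \<subseteq> N u" "{p, q} \<subseteq> N v"
      using inter by auto
    then have "card (N u - {p, q}) = 1" "card (N v - {p, q}) = 1"
      using pq u3 v3 by (simp_all add: card_Diff_subset)
    then obtain r w where "N u - {p, q} = {r}" "N v - {p, q} = {w}"
      by (auto simp: card_1_singleton_iff)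
    then have Nu: "N u = {p, q, r}" and Nv: "N v = {p, q, w}" and dist: "distinct [p, q, r]" "distinct [p, q, w]"
      using inter pq by auto
    have rw: "r \<noteq> w" "r \<notin> N v" "w \<notin> N u"
      using inter dist Nu Nv by auto
    have Np: "N p = {u, v}"
      using inter uv deg2_nbr by (intro nbrs_pairI) (auto intro: nbrs_sym)
    have Nq: "N q = {u, v}"
      using inter uv deg2_nbr by (intro nbrs_pairI) (auto intro: nbrs_sym)
    have vs: "v \<noteq> p" "v \<noteq> q" "v \<noteq> r" "v \<noteq> w" "u \<noteq> p" "u \<noteq> q" "u \<noteq> r" "u \<noteq> w"
      using uv(2) vu nbrs_irrefl[of u] nbrs_irrefl[of v] by (auto simp: Nu Nv)
    obtain r' where r': "N r = {u, r'}" "r' \<noteq> u" "r' \<notin> N u" "r \<in> N r'"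
      using outer[of r] Nu by auto
    have vw: "v \<in> N w"
      using Nv by (auto intro: nbrs_sym)
    obtain w' where w': "N w = {v, w'}" "w' \<noteq> v" "w' \<noteq> w" "w \<in> N w'"
      using other_nbr[OF deg2_nbr vw] Nv by auto
    have r'v: "r' \<noteq> v" and w'u: "w' \<noteq> u"
      using r'(4) w'(4) rw by auto
    show ?thesis
    proof (cases "r' = w")
      case True
      have Nw: "N w = {r, v}"
        using True vw r'(4) vs deg2_nbr Nv by (intro nbrs_pairI) auto
      have "distinct [p, u, r, w, v, q]"
        using dist rw vs uv by auto
      then have "\<exists>l. labelling G10 G l"
        unfolding G10_def
        by (intro labelling_listI[of "[p, u, r, w, v, q]"])
          (simp_all add: Nu Nv Np Nq Nw r'(1) True)
      then show ?thesis
        by simp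
    next
      case False
      have eq: "w' = r'"
      proof (rule ccontr)
        assume "w' \<noteq> r'"
        then have "p \<in> N r \<union> N r' \<union> N w \<union> N w'"
          using False vs w'u by (intro domination) (auto simp: r'(1) w'(1))
        moreover have "p \<noteq> r'" "p \<noteq> w'"
          using r'(4) w'(4) vs Np by auto
        ultimately have "p \<in> N r' \<or> p \<in> N w'"
          using vs by (auto simp: r'(1) w'(1))
        then show False
          using nbrs_sym[of p r'] nbrs_sym[of p w'] r'(2) r'v w'(2) w'u by (auto simp: Np)
      qed
      have Nr': "N r' = {r, w}"
        using r'(2,4) r'v w'(4) eq rw deg2 by (intro nbrs_pairI) auto
      have "r' \<noteq> p" "r' \<noteq> q" "r' \<noteq> r"
        using r'(3) by (auto simp: Nu)
      then have "distinct [p, u, r, r', w, v, q]"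
        using dist rw vs uv r'v r'(2) False by auto
      then have "\<exists>l. labelling G11 G l"
        unfolding G11_def
        by (intro labelling_listI[of "[p, u, r, r', w, v, q]"])
          (simp_all add: Nu Nv Np Nq Nr' r'(1) w'(1) eq)
      then show ?thesis
        by simp
    qed
  next
    case 4
    then have "N u \<inter> N v = N u" "N u \<inter> N v = N v"
      using u3 v3 card_subset_eq[of "N u" "N u \<inter> N v"] card_subset_eq[of "N v" "N u \<inter> N v"]
      by auto
    then have same: "N v = N u"
      by simp
    obtain p q r where Nu: "N u = {p, q, r}" and dist: "distinct [p, q, r]"
      using u3 by (auto simp: card_Suc_eq eval_nat_numeral)
    have Nw: "N w = {u, v}" if "w \<in> N u" for w
      using that uv deg2_nbr same by (intro nbrs_pairI) (auto intro: nbrs_sym)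
    have N3: "N p = {u, v}" "N q = {u, v}" "N r = {u, v}"
      using Nw Nu by auto
    have "distinct [p, u, q, v, r]"
      using dist uv vu nbrs_irrefl[of u] by (auto simp: Nu)
    then have "\<exists>l. labelling G9 G l"
      unfolding G9_def
      by (intro labelling_listI[of "[p, u, q, v, r]"]) (simp_all add: same Nu N3)
    then show ?thesis
      by simp
  qed
qed

end

section \<open>Elimination in labelled gain graphs\<close>

lemma edge_pivot_zero:
  fixes A :: "'a::field ^ 'n ^ 'n"
  assumes "A $ x $ x = 0" "A $ y $ y = 0" "A $ x $ y * A $ y $ x = 1"
  shows "edge_pivot x y A $ x $ j = 0" "edge_pivot x y A $ y $ j = 0"
    "edge_pivot x y A $ i $ x = 0" "edge_pivot x y A $ i $ y = 0"
proof -
  have "A $ y $ x * A $ x $ y = 1"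
    using assms(3) by (simp add: mult.commute)
  then show "edge_pivot x y A $ x $ j = 0" "edge_pivot x y A $ y $ j = 0"
    "edge_pivot x y A $ i $ x = 0" "edge_pivot x y A $ i $ y = 0"
    using assms by (simp_all add: edge_pivot_def mult.assoc)
qed

definition hermitian :: "complex ^ 'n ^ 'n \<Rightarrow> bool" where
  "hermitian A \<longleftrightarrow> (\<forall>i j. A $ j $ i = cnj (A $ i $ j))"

text \<open>Because of this symmetry only the entries on and above the diagonal need to be inspected after
  an elimination.\<close>

lemma hermitian_edge_pivot:
  assumes "hermitian A"
  shows "hermitian (edge_pivot x y A)"
proof -
  have cnj_A: "cnj (A $ i $ j) = A $ j $ i" for i j
    using assms unfolding hermitian_def by metis
  show ?thesis
    unfolding hermitian_def edge_pivot_def by (simp add: cnj_A algebra_simps)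
qed

lemma rank_star:
  fixes A :: "'a::field ^ 'n ^ 'n"
  assumes "\<And>i j. i \<noteq> c \<Longrightarrow> j \<noteq> c \<Longrightarrow> A $ i $ j = 0" and "A $ c $ c = 0"
    and "A $ c $ q \<noteq> 0" "A $ q $ c \<noteq> 0"
  shows "rank A = 2"
proof -
  have "q \<noteq> c"
    using assms(2,3) by auto
  let ?B = "pivot q c A"
  have B: "?B $ i $ j = (if i = c then A $ c $ j else 0)" for i j
    using assms \<open>q \<noteq> c\<close> by (cases "i = c"; cases "j = c") (simp_all add: pivot_def)
  have "rank (pivot c q ?B) = 0"
    using assms(3) by (simp add: rank_eq_0_iff pivot_def[of c q] B)
  moreover have "?B $ c $ q \<noteq> 0"
    using assms(3) by (simp add: B)
  ultimately show ?thesis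
    using rank_pivot[of A q c] rank_pivot[of ?B c q] assms(4) by simp
qed

lemma rank_diagonal_entry:
  fixes A :: "'a::field ^ 'n ^ 'n"
  assumes "\<And>i j. (i, j) \<noteq> (q, q) \<Longrightarrow> A $ i $ j = 0"
  shows "rank A = (if A $ q $ q = 0 then 0 else 1)"
proof (cases "A $ q $ q = 0")
  case True
  then show ?thesis
    using assms rank_eq_0_iff[of A] by (metis prod.inject)
next
  case False
  have "pivot q q A $ i $ j = 0" for i j
    using assms[of i j] assms[of q j] assms[of i q] False
    by (cases "i = q"; cases "j = q") (simp_all add: pivot_def)
  then have "rank (pivot q q A) = 0"
    by (simp add: rank_eq_0_iff)
  then show ?thesis
    using rank_pivot[of A q q] False by simp
qed

lemma rank_2x2_block:
  fixes A :: "'a::field ^ 'n ^ 'n"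
  assumes supp: "\<And>i j. i \<notin> {p, q} \<or> j \<notin> {p, q} \<Longrightarrow> A $ i $ j = 0" and "p \<noteq> q"
    and sym: "A $ p $ q = 0 \<longleftrightarrow> A $ q $ p = 0"
  shows "rank A =
    (if A $ p $ p * A $ q $ q \<noteq> A $ p $ q * A $ q $ p then 2
     else if A $ p $ p = 0 \<and> A $ q $ q = 0 then 0 else 1)"
proof -
  have main: "rank A = (if A $ p $ p * A $ q $ q \<noteq> A $ p $ q * A $ q $ p then 2 else 1)"
    if supp: "\<And>i j. i \<notin> {p, q} \<or> j \<notin> {p, q} \<Longrightarrow> A $ i $ j = 0" and "A $ p $ p \<noteq> 0" "p \<noteq> q"
    for p q
  proof -
    let ?B = "pivot p p A"
    have "?B $ i $ j = 0" if "(i, j) \<noteq> (q, q)" for i j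
    proof -
      consider "i = p" | "j = p" | "i \<notin> {p, q}" | "j \<notin> {p, q}"
        using \<open>(i, j) \<noteq> (q, q)\<close> by auto
      then show ?thesis
        using supp[of i j] supp[of i p] supp[of p j] \<open>A $ p $ p \<noteq> 0\<close>
        by cases (simp_all add: pivot_def)
    qed
    then have "rank ?B = (if ?B $ q $ q = 0 then 0 else 1)"
      by (rule rank_diagonal_entry)
    moreover have "?B $ q $ q = 0 \<longleftrightarrow> A $ p $ p * A $ q $ q = A $ p $ q * A $ q $ p"
      using \<open>A $ p $ p \<noteq> 0\<close> by (auto simp: pivot_def field_simps)
    ultimately show ?thesis
      using rank_pivot[of A p p] \<open>A $ p $ p \<noteq> 0\<close>
      by (cases "A $ p $ p * A $ q $ q = A $ p $ q * A $ q $ p") simp_all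
  qed
  consider "A $ p $ p \<noteq> 0" | "A $ q $ q \<noteq> 0" | "A $ p $ p = 0" "A $ q $ q = 0" "A $ p $ q = 0"
    | "A $ p $ p = 0" "A $ q $ q = 0" "A $ p $ q \<noteq> 0"
    by auto
  then show ?thesis
  proof cases
    case 1
    then show ?thesis
      using main[of p q] supp \<open>p \<noteq> q\<close> by simp
  next
    case 2
    then show ?thesis
      using main[of q p] supp \<open>p \<noteq> q\<close> by (simp add: mult.commute insert_commute)
  next
    case 3
    have "A $ i $ j = 0" for i j
      using 3 sym supp[of i j] by (cases "i \<in> {p, q} \<and> j \<in> {p, q}") auto
    then show ?thesis
      using rank_eq_0_iff[of A] by simp
  next
    case 4
    then have "rank A = 2"
      using supp sym \<open>p \<noteq> q\<close> by (intro rank_star[of p A q]) auto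
    then show ?thesis
      using 4 sym by simp
  qed
qed

context spanning_gain_graph
begin

lemma hermitian_A: "hermitian A"
  unfolding hermitian_def
proof (intro allI)
  fix i j
  show "A $ j $ i = cnj (A $ i $ j)"
  proof (cases "(i, j) \<in> parcs G")
    case True
    then have "\<phi> (i, j) * cnj (\<phi> (i, j)) = 1"
      by (simp add: complex_norm_square[symmetric] gain_unit)
    then have "inverse (\<phi> (i, j)) = cnj (\<phi> (i, j))"
      by (rule inverse_unique)
    then show ?thesis
      using True arcs_symmetric gain_reverse[of j i] by (simp add: adjacency_matrix_def)
  next
    case False
    then show ?thesis
      using arcs_symmetric[of j i] by (auto simp: adjacency_matrix_def)
  qed
qed

lemma A_loop: "A $ v $ v = 0"
  by (simp add: A_eq_0_iff nbrs_irrefl)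

lemma A_inverse:
  assumes "A $ i $ j \<noteq> 0"
  shows "A $ i $ j * A $ j $ i = 1"
proof -
  have "cmod (A $ i $ j) = 1"
    using assms by (auto simp: adjacency_matrix_def gain_unit split: if_splits)
  then have "A $ i $ j * cnj (A $ i $ j) = 1"
    using complex_norm_square[of "A $ i $ j"] by simp
  then show ?thesis
    using hermitian_A unfolding hermitian_def by metis
qed

lemma labelled_entry:
  assumes lab: "labelling (labelled_graph k E) G l" and E: "E \<subseteq> {1..k} \<times> {1..k}"
    and "i \<in> {1..k}" "j \<in> {1..k}"
  shows "A $ l i $ l j = (if (i, j) \<in> E \<or> (j, i) \<in> E then \<phi> (l i, l j) else 0)"
proof -
  have inj: "inj_on l {1..k}" and arcs: "parcs G = map_prod l l ` (E \<union> E\<inverse>)"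
    using lab by (auto simp: labelling_def labelled_graph_def bij_betw_def)
  have "inj_on (map_prod l l) ({1..k} \<times> {1..k})"
    using inj by (rule map_prod_inj_on[OF _ inj])
  then have "map_prod l l (i, j) \<in> map_prod l l ` (E \<union> E\<inverse>) \<longleftrightarrow> (i, j) \<in> E \<union> E\<inverse>"
    by (rule inj_on_image_mem_iff) (use E assms(3,4) in auto)
  then have "(l i, l j) \<in> parcs G \<longleftrightarrow> (i, j) \<in> E \<or> (j, i) \<in> E"
    by (simp add: arcs)
  then show ?thesis
    by (simp add: adjacency_matrix_def)
qed

lemma all_labelled:
  assumes lab: "labelling (labelled_graph k E) G l"
  shows "(\<forall>w. P w) \<longleftrightarrow> (\<forall>i\<in>{1..k}. P (l i))"
proof -
  have "UNIV = l ` {1..k}"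
    using lab by (auto simp: labelling_def labelled_graph_def bij_betw_def pverts_UNIV)
  then show ?thesis
    by (metis imageE imageI UNIV_I)
qed

text \<open>Eliminating the edges with labels \<open>x y\<close> and \<open>u v\<close> leaves a matrix supported on the remaining
  labels \<open>K\<close>. For each of the labelled graphs with at least five vertices except \<open>G9\<close>, its entries
  turn out to be the expressions that define the gain condition.\<close>

lemma rank_labelled:
  assumes lab: "labelling (labelled_graph k E) G l" and E: "E \<subseteq> {1..k} \<times> {1..k}"
    and labels: "{1..k} = insert x (insert y (insert u (insert v K)))"
    and edges: "(x, y) \<in> E \<or> (y, x) \<in> E" "(u, v) \<in> E \<or> (v, u) \<in> E"
    and non_edges: "(x, u) \<notin> E" "(u, x) \<notin> E" "(x, v) \<notin> E" "(v, x) \<notin> E"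
  defines "M \<equiv> edge_pivot (l u) (l v) (edge_pivot (l x) (l y) A)"
  shows "4 \<le> rank A" "rank A = 4 \<longleftrightarrow> (\<forall>i\<in>K. \<forall>j\<in>K. i \<le> j \<longrightarrow> M $ l i $ l j = 0)"
proof -
  let ?A1 = "edge_pivot (l x) (l y) A"
  have in_range: "x \<in> {1..k}" "y \<in> {1..k}" "u \<in> {1..k}" "v \<in> {1..k}"
    unfolding labels by simp_all
  note entry = labelled_entry[OF lab E]
  have zero: "A $ l x $ l u = 0" "A $ l u $ l x = 0" "A $ l x $ l v = 0" "A $ l v $ l x = 0"
    using in_range non_edges by (simp_all add: entry)
  have adj: "(l i, l j) \<in> parcs G" if "(i, j) \<in> E \<or> (j, i) \<in> E" for i j
    using lab that by (force simp: labelling_def labelled_graph_def)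
  have unit: "A $ l x $ l y * A $ l y $ l x = 1" "A $ l u $ l v * A $ l v $ l u = 1"
    using edges[THEN adj] by (auto intro!: A_inverse simp: A_eq_0_iff nbrs_def)
  have rank_M: "rank A = rank M + 4"
    unfolding M_def using zero unit by (intro rank_two_edge_pivots) (simp_all add: A_loop)
  then show "4 \<le> rank A"
    by simp
  have A1: "?A1 $ l u $ l u = 0" "?A1 $ l v $ l v = 0" "?A1 $ l u $ l v * ?A1 $ l v $ l u = 1"
    using zero unit by (simp_all add: edge_pivot_def A_loop)
  have zero_xy: "?A1 $ l x $ w = 0" "?A1 $ l y $ w = 0" "?A1 $ w $ l x = 0" "?A1 $ w $ l y = 0" for w
    using edge_pivot_zero[OF A_loop A_loop unit(1)] by auto
  have zero_uv: "M $ l u $ w = 0" "M $ l v $ w = 0" "M $ w $ l u = 0" "M $ w $ l v = 0" for w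
    unfolding M_def using edge_pivot_zero[OF A1] by auto
  have zero_xy': "M $ l x $ w = 0" "M $ l y $ w = 0" "M $ w $ l x = 0" "M $ w $ l y = 0" for w
    unfolding M_def using zero_xy by (simp_all add: edge_pivot_def[of "l u"])
  have "hermitian M"
    unfolding M_def by (intro hermitian_edge_pivot hermitian_A)
  then have flip: "M $ j $ i = 0 \<longleftrightarrow> M $ i $ j = 0" for i j
    unfolding hermitian_def by (metis complex_cnj_zero_iff)
  have "rank A = 4 \<longleftrightarrow> (\<forall>i j. M $ i $ j = 0)"
    using rank_M by (simp add: rank_eq_0_iff)
  also have "\<dots> \<longleftrightarrow> (\<forall>i\<in>{1..k}. \<forall>j\<in>{1..k}. M $ l i $ l j = 0)"
    using all_labelled[OF lab, of "\<lambda>i. \<forall>j. M $ i $ j = 0"]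
      all_labelled[OF lab, of "\<lambda>j. M $ i $ j = 0" for i] by simp
  also have "\<dots> \<longleftrightarrow> (\<forall>i\<in>K. \<forall>j\<in>K. M $ l i $ l j = 0)"
    unfolding labels by (simp add: zero_uv zero_xy')
  also have "\<dots> \<longleftrightarrow> (\<forall>i\<in>K. \<forall>j\<in>K. i \<le> j \<longrightarrow> M $ l i $ l j = 0)"
    using flip by (metis linear)
  finally show "rank A = 4 \<longleftrightarrow> (\<forall>i\<in>K. \<forall>j\<in>K. i \<le> j \<longrightarrow> M $ l i $ l j = 0)" .
qed

end

section \<open>The rank of each labelled gain graph\<close>

text \<open>The label 1 has to stay a numeral, so that terms with labels have one form only.\<close>

declare One_nat_def [simp del]

lemmas cycle_type_defs = type_A_def type_B_def type_C_def type_D_def type_E_def cycle_gains_def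

context spanning_gain_graph
begin

text \<open>One formula, and not a rule with premise \<open>(i, j) \<in> E\<close>: for a concrete edge set it simplifies to
  a finite list of unconditional rewrite rules.\<close>

lemma labelled_gains:
  assumes "labelling (labelled_graph k E) G l"
  shows "\<forall>(i, j)\<in>E. \<phi> (l j, l i) = cnj (\<phi> (l i, l j)) \<and> \<phi> (l i, l j) * cnj (\<phi> (l i, l j)) = 1
    \<and> cnj (\<phi> (l i, l j)) * \<phi> (l i, l j) = 1 \<and> inverse (\<phi> (l i, l j)) = cnj (\<phi> (l i, l j))"
proof (intro ballI, clarify)
  fix i j assume "(i, j) \<in> E"
  then have arcs: "(l i, l j) \<in> parcs G" "(l j, l i) \<in> parcs G"
    using assms by (force simp: labelling_def labelled_graph_def)+
  have "A $ l j $ l i = cnj (A $ l i $ l j)"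
    using hermitian_A unfolding hermitian_def by blast
  then have cnj: "\<phi> (l j, l i) = cnj (\<phi> (l i, l j))"
    using arcs by (simp add: adjacency_matrix_def)
  have unit: "\<phi> (l i, l j) * cnj (\<phi> (l i, l j)) = 1"
    using complex_norm_square[of "\<phi> (l i, l j)"] gain_unit[OF arcs(1)] by simp
  then have "inverse (\<phi> (l i, l j)) = cnj (\<phi> (l i, l j))"
    by (rule inverse_unique)
  moreover have "cnj (\<phi> (l i, l j)) * \<phi> (l i, l j) = 1"
    using unit by (simp add: mult.commute)
  ultimately show "\<phi> (l j, l i) = cnj (\<phi> (l i, l j)) \<and> \<phi> (l i, l j) * cnj (\<phi> (l i, l j)) = 1
    \<and> cnj (\<phi> (l i, l j)) * \<phi> (l i, l j) = 1 \<and> inverse (\<phi> (l i, l j)) = cnj (\<phi> (l i, l j))"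
    using cnj unit by simp
qed

text \<open>Bridges the two forms of the type A condition: the vanishing of an entry after elimination
  expresses one gain by the others, while the definition singles out the gain of the closing arc.\<close>

lemma unit_transfer:
  fixes a b x y :: complex
  assumes "a * cnj a = 1" "b * cnj b = 1"
  shows "x = cnj a * y * cnj b \<longleftrightarrow> a * x * b = y"
proof -
  have "a * (cnj a * y * cnj b) * b = (a * cnj a) * y * (b * cnj b)"
    by (simp only: mult_ac)
  moreover have "cnj a * (a * x * b) * cnj b = (a * cnj a) * x * (b * cnj b)"
    by (simp only: mult_ac)
  ultimately show ?thesis
    using assms by (metis mult_1 mult_1_right)
qed

text \<open>Only the common vertex of the two triangles is left after eliminating the opposite edges, with
  a diagonal entry to which each triangle contributes twice the real part of its gain, negated.\<close>

lemma rank_G1: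
  assumes "labelling G1 G l"
  shows "4 \<le> rank A"
    "rank A = 4 \<longleftrightarrow> Re (- \<phi> (l 1, l 5) * (\<phi> (l 5, l 2) / \<phi> (l 1, l 2)))
       + Re (- \<phi> (l 3, l 5) * (\<phi> (l 5, l 4) / \<phi> (l 3, l 4))) = 0"
    (is "_ \<longleftrightarrow> ?r = 0")
proof -
  note lab = assms[unfolded G1_def]
  note entry = labelled_entry[OF lab, simplified] and gain = labelled_gains[OF lab, simplified]
  let ?M = "edge_pivot (l 3) (l 4) (edge_pivot (l 1) (l 2) A)"
  have labels: "{1..5::nat} = {1, 2, 3, 4, 5}"
    by auto
  show "4 \<le> rank A"
    by (rule rank_labelled[OF lab _ labels]) simp_all
  have "rank A = 4 \<longleftrightarrow> (\<forall>i\<in>{5}. \<forall>j\<in>{5}. i \<le> j \<longrightarrow> ?M $ l i $ l j = 0)"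
    by (rule rank_labelled[OF lab _ labels]) simp_all
  moreover have "?M $ l 5 $ l 5 = 0 \<longleftrightarrow> ?r = 0"
  proof -
    have "?M $ l 5 $ l 5 = of_real (2 * ?r)"
      by (simp add: edge_pivot_def entry gain divide_inverse complex_eq_iff algebra_simps)
    then show ?thesis
      by (simp only: of_real_eq_0_iff mult_eq_0_iff) simp
  qed
  ultimately show "rank A = 4 \<longleftrightarrow> ?r = 0"
    by auto
qed

text \<open>Of the two remaining vertices 3 and 6, the first carries the triangle as a diagonal entry, and
  the entry between them compares the edge \<open>36\<close> with the path \<open>3, 4, 5, 6\<close>.\<close>

lemma rank_G2:
  assumes "labelling G2 G l"
  shows "4 \<le> rank A"
    "rank A = 4 \<longleftrightarrow> type_A \<phi> (map l [3,4,5,6]) \<and> type_E \<phi> (map l [1,2,3])"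
proof -
  note lab = assms[unfolded G2_def]
  note entry = labelled_entry[OF lab, simplified] and gain = labelled_gains[OF lab, simplified]
  let ?M = "edge_pivot (l 4) (l 5) (edge_pivot (l 1) (l 2) A)"
  have labels: "{1..6::nat} = {1, 2, 4, 5, 3, 6}"
    by auto
  show "4 \<le> rank A"
    by (rule rank_labelled[OF lab _ labels]) simp_all
  have "rank A = 4 \<longleftrightarrow> (\<forall>i\<in>{3, 6}. \<forall>j\<in>{3, 6}. i \<le> j \<longrightarrow> ?M $ l i $ l j = 0)"
    by (rule rank_labelled[OF lab _ labels]) simp_all
  moreover have "?M $ l 6 $ l 6 = 0"
    by (simp_all add: edge_pivot_def entry)
  moreover have "?M $ l 3 $ l 3 = 0 \<longleftrightarrow> type_E \<phi> (map l [1,2,3])"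
  proof -
    have "?M $ l 3 $ l 3 = of_real (2 * Re ((-1) ^ 1 * prod_list (cycle_gains \<phi> (map l [1,2,3]))))"
      by (simp add: edge_pivot_def entry gain cycle_gains_def complex_eq_iff algebra_simps)
    then show ?thesis
      by (simp only: of_real_eq_0_iff mult_eq_0_iff) (simp add: type_E_def)
  qed
  moreover have "?M $ l 3 $ l 6 = 0 \<longleftrightarrow> type_A \<phi> (map l [3,4,5,6])"
    by (simp add: edge_pivot_def entry gain cycle_type_defs algebra_simps)
  ultimately show "rank A = 4 \<longleftrightarrow> type_A \<phi> (map l [3,4,5,6]) \<and> type_E \<phi> (map l [1,2,3])"
    by auto
qed

text \<open>Each four-cycle has two remaining vertices, 2 and 4 or 4 and 7, and the entry between them
  compares the remaining edge with the eliminated path.\<close>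

lemma rank_G3:
  assumes "labelling G3 G l"
  shows "4 \<le> rank A"
    "rank A = 4 \<longleftrightarrow> type_A \<phi> (map l [1,2,4,3]) \<and> type_A \<phi> (map l [4,5,6,7])"
proof -
  note lab = assms[unfolded G3_def]
  note entry = labelled_entry[OF lab, simplified] and gain = labelled_gains[OF lab, simplified]
  let ?M = "edge_pivot (l 5) (l 6) (edge_pivot (l 1) (l 3) A)"
  have labels: "{1..7::nat} = {1, 3, 5, 6, 2, 4, 7}"
    by auto
  show "4 \<le> rank A"
    by (rule rank_labelled[OF lab _ labels]) simp_all
  have "rank A = 4 \<longleftrightarrow> (\<forall>i\<in>{2, 4, 7}. \<forall>j\<in>{2, 4, 7}. i \<le> j \<longrightarrow> ?M $ l i $ l j = 0)"
    by (rule rank_labelled[OF lab _ labels]) simp_all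
  moreover have "?M $ l 2 $ l 2 = 0" "?M $ l 2 $ l 7 = 0" "?M $ l 4 $ l 4 = 0" "?M $ l 7 $ l 7 = 0"
    by (simp_all add: edge_pivot_def entry)
  moreover have "?M $ l 2 $ l 4 = 0 \<longleftrightarrow> type_A \<phi> (map l [1,2,4,3])"
  proof -
    have "?M $ l 2 $ l 4 =
        \<phi> (l 2, l 4) - cnj (\<phi> (l 1, l 2)) * \<phi> (l 1, l 3) * cnj (\<phi> (l 4, l 3))"
      by (simp add: edge_pivot_def entry gain)
    then have "?M $ l 2 $ l 4 = 0 \<longleftrightarrow>
        \<phi> (l 2, l 4) = cnj (\<phi> (l 1, l 2)) * \<phi> (l 1, l 3) * cnj (\<phi> (l 4, l 3))"
      by (metis right_minus_eq)
    also have "\<dots> \<longleftrightarrow> \<phi> (l 1, l 2) * \<phi> (l 2, l 4) * \<phi> (l 4, l 3) = \<phi> (l 1, l 3)"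
      by (rule unit_transfer) (simp_all add: gain)
    finally show ?thesis
      by (auto simp: cycle_type_defs gain mult.assoc)
  qed
  moreover have "?M $ l 4 $ l 7 = 0 \<longleftrightarrow> type_A \<phi> (map l [4,5,6,7])"
    by (simp add: edge_pivot_def entry gain cycle_type_defs algebra_simps)
  ultimately show "rank A = 4 \<longleftrightarrow> type_A \<phi> (map l [1,2,4,3]) \<and> type_A \<phi> (map l [4,5,6,7])"
    by auto
qed

text \<open>The remaining vertex 5 collects the triangle and the five-cycle as diagonal entries.\<close>

lemma rank_G6:
  assumes "labelling G6 G l"
  shows "4 \<le> rank A"
    "rank A = 4 \<longleftrightarrow> Re (- \<phi> (l 1, l 5) * (\<phi> (l 5, l 2) / \<phi> (l 1, l 2)))
       + Re ((\<phi> (l 1, l 5) * \<phi> (l 3, l 2) * \<phi> (l 5, l 4)) / (\<phi> (l 1, l 2) * \<phi> (l 3, l 4))) = 0"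
    (is "_ \<longleftrightarrow> ?r = 0")
proof -
  note lab = assms[unfolded G6_def]
  note entry = labelled_entry[OF lab, simplified] and gain = labelled_gains[OF lab, simplified]
  let ?M = "edge_pivot (l 3) (l 4) (edge_pivot (l 1) (l 2) A)"
  have labels: "{1..5::nat} = {1, 2, 3, 4, 5}"
    by auto
  show "4 \<le> rank A"
    by (rule rank_labelled[OF lab _ labels]) simp_all
  have "rank A = 4 \<longleftrightarrow> (\<forall>i\<in>{5}. \<forall>j\<in>{5}. i \<le> j \<longrightarrow> ?M $ l i $ l j = 0)"
    by (rule rank_labelled[OF lab _ labels]) simp_all
  moreover have "?M $ l 5 $ l 5 = 0 \<longleftrightarrow> ?r = 0"
  proof -
    have "?M $ l 5 $ l 5 = of_real (2 * ?r)"
      by (simp add: edge_pivot_def entry gain divide_inverse complex_eq_iff algebra_simps)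
    then show ?thesis
      by (simp only: of_real_eq_0_iff mult_eq_0_iff) simp
  qed
  ultimately show "rank A = 4 \<longleftrightarrow> ?r = 0"
    by auto
qed

text \<open>After elimination the vertices 2 and 5 remain; the triangle contributes to the diagonal at 2,
  the two paths of the hexagon to the entry between 2 and 5.\<close>

lemma rank_G7:
  assumes "labelling G7 G l"
  shows "4 \<le> rank A"
    "rank A = 4 \<longleftrightarrow> type_E \<phi> (map l [1,2,6]) \<and> type_A \<phi> (map l [1,2,3,4,5,6])"
proof -
  note lab = assms[unfolded G7_def]
  note entry = labelled_entry[OF lab, simplified] and gain = labelled_gains[OF lab, simplified]
  let ?M = "edge_pivot (l 1) (l 6) (edge_pivot (l 3) (l 4) A)"
  have labels: "{1..6::nat} = {3, 4, 1, 6, 2, 5}"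
    by auto
  show "4 \<le> rank A"
    by (rule rank_labelled[OF lab _ labels]) simp_all
  have "rank A = 4 \<longleftrightarrow> (\<forall>i\<in>{2, 5}. \<forall>j\<in>{2, 5}. i \<le> j \<longrightarrow> ?M $ l i $ l j = 0)"
    by (rule rank_labelled[OF lab _ labels]) simp_all
  moreover have "?M $ l 5 $ l 5 = 0"
    by (simp_all add: edge_pivot_def entry)
  moreover have "?M $ l 2 $ l 2 = 0 \<longleftrightarrow> type_E \<phi> (map l [1,2,6])"
  proof -
    have "?M $ l 2 $ l 2 = of_real (2 * Re ((-1) ^ 1 * prod_list (cycle_gains \<phi> (map l [1,2,6]))))"
      by (simp add: edge_pivot_def entry gain cycle_gains_def complex_eq_iff algebra_simps)
    then show ?thesis
      by (simp only: of_real_eq_0_iff mult_eq_0_iff) (simp add: type_E_def)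
  qed
  moreover have "?M $ l 2 $ l 5 = 0 \<longleftrightarrow> type_A \<phi> (map l [1,2,3,4,5,6])"
  proof -
    have "?M $ l 2 $ l 5 =
        cnj (\<phi> (l 1, l 2)) * (- \<phi> (l 1, l 6)) * cnj (\<phi> (l 5, l 6)) - \<phi> (l 2, l 3) * \<phi> (l 3, l 4) * \<phi> (l 4, l 5)"
      by (simp add: edge_pivot_def entry gain)
    then have "?M $ l 2 $ l 5 = 0 \<longleftrightarrow>
        \<phi> (l 2, l 3) * \<phi> (l 3, l 4) * \<phi> (l 4, l 5) = cnj (\<phi> (l 1, l 2)) * (- \<phi> (l 1, l 6)) * cnj (\<phi> (l 5, l 6))"
      by (metis right_minus_eq)
    also have "\<dots> \<longleftrightarrow> \<phi> (l 1, l 2) * (\<phi> (l 2, l 3) * \<phi> (l 3, l 4) * \<phi> (l 4, l 5)) * \<phi> (l 5, l 6) = - \<phi> (l 1, l 6)"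
      by (rule unit_transfer) (simp_all add: gain)
    finally show ?thesis
      by (auto simp: cycle_type_defs gain mult.assoc)
  qed
  ultimately show "rank A = 4 \<longleftrightarrow> type_E \<phi> (map l [1,2,6]) \<and> type_A \<phi> (map l [1,2,3,4,5,6])"
    by auto
qed

text \<open>The three paths from 2 to 5 contribute one term each to the entry between these vertices, the
  only one above or on the diagonal that can be nonzero. It is the conjugate of the stated expression up to a unit factor.\<close>

lemma rank_G8:
  assumes "labelling G8 G l"
  shows "4 \<le> rank A"
    "rank A = 4 \<longleftrightarrow> \<phi> (l 1, l 6) * \<phi> (l 3, l 2) * \<phi> (l 5, l 4)
       - \<phi> (l 1, l 6) * \<phi> (l 3, l 4) * \<phi> (l 5, l 2)
       + \<phi> (l 1, l 2) * \<phi> (l 3, l 4) * \<phi> (l 5, l 6) = 0"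
    (is "_ \<longleftrightarrow> ?c = 0")
proof -
  note lab = assms[unfolded G8_def]
  note entry = labelled_entry[OF lab, simplified] and gain = labelled_gains[OF lab, simplified]
  let ?M = "edge_pivot (l 1) (l 6) (edge_pivot (l 3) (l 4) A)"
  have labels: "{1..6::nat} = {3, 4, 1, 6, 2, 5}"
    by auto
  show "4 \<le> rank A"
    by (rule rank_labelled[OF lab _ labels]) simp_all
  have "rank A = 4 \<longleftrightarrow> (\<forall>i\<in>{2, 5}. \<forall>j\<in>{2, 5}. i \<le> j \<longrightarrow> ?M $ l i $ l j = 0)"
    by (rule rank_labelled[OF lab _ labels]) simp_all
  moreover have "?M $ l 2 $ l 2 = 0" "?M $ l 5 $ l 5 = 0"
    by (simp_all add: edge_pivot_def entry)
  moreover have "?M $ l 2 $ l 5 = 0 \<longleftrightarrow> ?c = 0"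
  proof -
    have identity: "a * b' * c' - a * d * p' + q * d * r = - (a * d * (p' - b' * d' * c' - q * a' * r))"
      if "a * a' = 1" "d * d' = 1" for a a' b' c' d d' p' q r :: complex
      using that by algebra
    have unit: "\<phi> (l 1, l 6) * cnj (\<phi> (l 1, l 6)) = 1" "\<phi> (l 3, l 4) * cnj (\<phi> (l 3, l 4)) = 1"
      by (simp_all add: gain)
    have "?c = - (\<phi> (l 1, l 6) * \<phi> (l 3, l 4) * cnj (?M $ l 2 $ l 5))"
      using identity[OF unit] by (simp add: edge_pivot_def entry gain)
    moreover have "\<phi> (l 1, l 6) \<noteq> 0" "\<phi> (l 3, l 4) \<noteq> 0"
      using unit by auto
    ultimately show ?thesis
      by simp
  qed
  ultimately show "rank A = 4 \<longleftrightarrow> ?c = 0"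
    by auto
qed

text \<open>Vertex 2 carries the five-cycle as a diagonal entry; the entry between 2 and 6 compares the edge
  \<open>26\<close> with the path \<open>2, 1, 5, 6\<close>.\<close>

lemma rank_G10:
  assumes "labelling G10 G l"
  shows "4 \<le> rank A"
    "rank A = 4 \<longleftrightarrow> type_E \<phi> (map l [1,2,3,4,5]) \<and> type_A \<phi> (map l [1,2,6,5])"
proof -
  note lab = assms[unfolded G10_def]
  note entry = labelled_entry[OF lab, simplified] and gain = labelled_gains[OF lab, simplified]
  let ?M = "edge_pivot (l 1) (l 5) (edge_pivot (l 3) (l 4) A)"
  have labels: "{1..6::nat} = {3, 4, 1, 5, 2, 6}"
    by auto
  show "4 \<le> rank A"
    by (rule rank_labelled[OF lab _ labels]) simp_all
  have "rank A = 4 \<longleftrightarrow> (\<forall>i\<in>{2, 6}. \<forall>j\<in>{2, 6}. i \<le> j \<longrightarrow> ?M $ l i $ l j = 0)"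
    by (rule rank_labelled[OF lab _ labels]) simp_all
  moreover have "?M $ l 6 $ l 6 = 0"
    by (simp_all add: edge_pivot_def entry)
  moreover have "?M $ l 2 $ l 2 = 0 \<longleftrightarrow> type_E \<phi> (map l [1,2,3,4,5])"
  proof -
    have "?M $ l 2 $ l 2 = of_real (2 * Re ((-1) ^ 2 * prod_list (cycle_gains \<phi> (map l [1,2,3,4,5]))))"
      by (simp add: edge_pivot_def entry gain cycle_gains_def complex_eq_iff algebra_simps)
    then show ?thesis
      by (simp only: of_real_eq_0_iff mult_eq_0_iff) (simp add: type_E_def)
  qed
  moreover have "?M $ l 2 $ l 6 = 0 \<longleftrightarrow> type_A \<phi> (map l [1,2,6,5])"
  proof -
    have "?M $ l 2 $ l 6 =
        \<phi> (l 2, l 6) - cnj (\<phi> (l 1, l 2)) * \<phi> (l 1, l 5) * cnj (\<phi> (l 6, l 5))"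
      by (simp add: edge_pivot_def entry gain)
    then have "?M $ l 2 $ l 6 = 0 \<longleftrightarrow>
        \<phi> (l 2, l 6) = cnj (\<phi> (l 1, l 2)) * \<phi> (l 1, l 5) * cnj (\<phi> (l 6, l 5))"
      by (metis right_minus_eq)
    also have "\<dots> \<longleftrightarrow> \<phi> (l 1, l 2) * \<phi> (l 2, l 6) * \<phi> (l 6, l 5) = \<phi> (l 1, l 5)"
      by (rule unit_transfer) (simp_all add: gain)
    finally show ?thesis
      by (auto simp: cycle_type_defs gain mult.assoc)
  qed
  ultimately show "rank A = 4 \<longleftrightarrow> type_E \<phi> (map l [1,2,3,4,5]) \<and> type_A \<phi> (map l [1,2,6,5])"
    by auto
qed

text \<open>The entries between 2 and 5 and between 2 and 7 belong to the hexagon and to the four-cycle.\<close>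

lemma rank_G11:
  assumes "labelling G11 G l"
  shows "4 \<le> rank A"
    "rank A = 4 \<longleftrightarrow> type_A \<phi> (map l [1,2,3,4,5,6]) \<and> type_A \<phi> (map l [1,2,7,6])"
proof -
  note lab = assms[unfolded G11_def]
  note entry = labelled_entry[OF lab, simplified] and gain = labelled_gains[OF lab, simplified]
  let ?M = "edge_pivot (l 1) (l 6) (edge_pivot (l 3) (l 4) A)"
  have labels: "{1..7::nat} = {3, 4, 1, 6, 2, 5, 7}"
    by auto
  show "4 \<le> rank A"
    by (rule rank_labelled[OF lab _ labels]) simp_all
  have "rank A = 4 \<longleftrightarrow> (\<forall>i\<in>{2, 5, 7}. \<forall>j\<in>{2, 5, 7}. i \<le> j \<longrightarrow> ?M $ l i $ l j = 0)"
    by (rule rank_labelled[OF lab _ labels]) simp_all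
  moreover have "?M $ l 2 $ l 2 = 0" "?M $ l 5 $ l 5 = 0" "?M $ l 7 $ l 7 = 0" "?M $ l 5 $ l 7 = 0"
    by (simp_all add: edge_pivot_def entry)
  moreover have "?M $ l 2 $ l 5 = 0 \<longleftrightarrow> type_A \<phi> (map l [1,2,3,4,5,6])"
  proof -
    have "?M $ l 2 $ l 5 =
        cnj (\<phi> (l 1, l 2)) * (- \<phi> (l 1, l 6)) * cnj (\<phi> (l 5, l 6)) - \<phi> (l 2, l 3) * \<phi> (l 3, l 4) * \<phi> (l 4, l 5)"
      by (simp add: edge_pivot_def entry gain)
    then have "?M $ l 2 $ l 5 = 0 \<longleftrightarrow>
        \<phi> (l 2, l 3) * \<phi> (l 3, l 4) * \<phi> (l 4, l 5) = cnj (\<phi> (l 1, l 2)) * (- \<phi> (l 1, l 6)) * cnj (\<phi> (l 5, l 6))"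
      by (metis right_minus_eq)
    also have "\<dots> \<longleftrightarrow> \<phi> (l 1, l 2) * (\<phi> (l 2, l 3) * \<phi> (l 3, l 4) * \<phi> (l 4, l 5)) * \<phi> (l 5, l 6) = - \<phi> (l 1, l 6)"
      by (rule unit_transfer) (simp_all add: gain)
    finally show ?thesis
      by (auto simp: cycle_type_defs gain mult.assoc)
  qed
  moreover have "?M $ l 2 $ l 7 = 0 \<longleftrightarrow> type_A \<phi> (map l [1,2,7,6])"
  proof -
    have "?M $ l 2 $ l 7 =
        \<phi> (l 2, l 7) - cnj (\<phi> (l 1, l 2)) * \<phi> (l 1, l 6) * cnj (\<phi> (l 7, l 6))"
      by (simp add: edge_pivot_def entry gain)
    then have "?M $ l 2 $ l 7 = 0 \<longleftrightarrow>
        \<phi> (l 2, l 7) = cnj (\<phi> (l 1, l 2)) * \<phi> (l 1, l 6) * cnj (\<phi> (l 7, l 6))"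
      by (metis right_minus_eq)
    also have "\<dots> \<longleftrightarrow> \<phi> (l 1, l 2) * \<phi> (l 2, l 7) * \<phi> (l 7, l 6) = \<phi> (l 1, l 6)"
      by (rule unit_transfer) (simp_all add: gain)
    finally show ?thesis
      by (auto simp: cycle_type_defs gain mult.assoc)
  qed
  ultimately show "rank A = 4 \<longleftrightarrow> type_A \<phi> (map l [1,2,3,4,5,6]) \<and> type_A \<phi> (map l [1,2,7,6])"
    by auto
qed

lemma rank_labelled_one_pivot:
  assumes lab: "labelling (labelled_graph k E) G l" and E: "E \<subseteq> {1..k} \<times> {1..k}"
    and edge: "(x, y) \<in> E"
  shows "rank A = rank (edge_pivot (l x) (l y) A) + 2"
    "edge_pivot (l x) (l y) A $ l x $ w = 0" "edge_pivot (l x) (l y) A $ l y $ w = 0"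
    "edge_pivot (l x) (l y) A $ w $ l x = 0" "edge_pivot (l x) (l y) A $ w $ l y = 0"
proof -
  have "(l x, l y) \<in> parcs G"
    using lab edge by (force simp: labelling_def labelled_graph_def)
  then have unit: "A $ l x $ l y * A $ l y $ l x = 1"
    by (intro A_inverse) (simp add: A_eq_0_iff nbrs_def)
  show "rank A = rank (edge_pivot (l x) (l y) A) + 2"
    by (rule rank_edge_pivot[OF A_loop A_loop unit])
  show "edge_pivot (l x) (l y) A $ l x $ w = 0" "edge_pivot (l x) (l y) A $ l y $ w = 0"
    "edge_pivot (l x) (l y) A $ w $ l x = 0" "edge_pivot (l x) (l y) A $ w $ l y = 0"
    by (rule edge_pivot_zero[OF A_loop A_loop unit])+
qed

lemma labelled_vertex:
  assumes lab: "labelling (labelled_graph k E) G l"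
  obtains i where "i \<in> {1..k}" "w = l i"
proof -
  have "w \<in> l ` {1..k}"
    using lab by (simp add: labelling_def labelled_graph_def bij_betw_def pverts_UNIV)
  then show thesis
    using that by auto
qed

text \<open>Eliminating the edge \<open>12\<close> leaves a star with centre 4 and leaves 3 and 5, whose two entries
  vanish according to the types of the two cycles. A star that is not zero has rank 2.\<close>

lemma rank_G9:
  assumes "labelling G9 G l"
  shows "rank A =
    (if type_A \<phi> (map l [1,2,3,4]) \<and> type_A \<phi> (map l [1,2,5,4]) then 2 else 4)"
proof -
  note lab = assms[unfolded G9_def]
  note entry = labelled_entry[OF lab, simplified] and gain = labelled_gains[OF lab, simplified]
  let ?M = "edge_pivot (l 1) (l 2) A"
  have labels: "{1..5::nat} = {1, 2, 3, 4, 5}"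
    by auto
  note pivoted = rank_labelled_one_pivot[OF lab, of 1 2, simplified]
  have M44: "?M $ l 4 $ l 4 = 0"
    by (simp add: edge_pivot_def entry)
  have "?M $ l 3 $ l 3 = 0" "?M $ l 3 $ l 5 = 0" "?M $ l 5 $ l 3 = 0" "?M $ l 5 $ l 5 = 0"
    by (simp_all add: edge_pivot_def entry)
  then have off: "?M $ i $ j = 0" if "i \<noteq> l 4" "j \<noteq> l 4" for i j
    using that pivoted(2-5) labelled_vertex[OF lab, of i] labelled_vertex[OF lab, of j]
    unfolding labels by (smt (verit) insert_iff singletonD)
  have herm: "?M $ j $ i = cnj (?M $ i $ j)" for i j
    using hermitian_edge_pivot[OF hermitian_A] unfolding hermitian_def by blast
  have type_A_iff: "?M $ l q $ l 4 = 0 \<longleftrightarrow> type_A \<phi> (map l [1, 2, q, 4])" if "q \<in> {3, 5}" for q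
  proof -
    have "?M $ l q $ l 4 = \<phi> (l q, l 4) - cnj (\<phi> (l 2, l q)) * \<phi> (l 1, l 4) * cnj (\<phi> (l 1, l 2))"
      using that by (auto simp: edge_pivot_def entry gain)
    then have "?M $ l q $ l 4 = 0 \<longleftrightarrow>
        \<phi> (l q, l 4) = cnj (\<phi> (l 2, l q)) * \<phi> (l 1, l 4) * cnj (\<phi> (l 1, l 2))"
      by (metis right_minus_eq)
    also have "\<dots> \<longleftrightarrow> \<phi> (l 2, l q) * \<phi> (l q, l 4) * \<phi> (l 1, l 2) = \<phi> (l 1, l 4)"
      using that by (intro unit_transfer) (auto simp: gain)
    finally show ?thesis
      by (auto simp: cycle_type_defs gain mult_ac)
  qed
  show ?thesis
  proof (cases "?M $ l 3 $ l 4 = 0 \<and> ?M $ l 5 $ l 4 = 0")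
    case True
    then have "?M $ i $ l 4 = 0" for i
      using M44 pivoted(2,3) labelled_vertex[OF lab, of i]
      unfolding labels by (smt (verit) insert_iff singletonD)
    moreover from this have "?M $ l 4 $ i = 0" for i
      using herm[of i "l 4"] by simp
    ultimately have "?M $ i $ j = 0" for i j
      using off by metis
    then have "rank ?M = 0"
      by (simp add: rank_eq_0_iff)
    then show ?thesis
      using True type_A_iff[of 3] type_A_iff[of 5] pivoted(1) by simp
  next
    case False
    then obtain q where q: "?M $ q $ l 4 \<noteq> 0"
      by auto
    then have "?M $ l 4 $ q \<noteq> 0"
      using herm[of q "l 4"] by auto
    then have "rank ?M = 2"
      using off M44 q by (intro rank_star[of "l 4" ?M q]) auto
    then show ?thesis
      using False type_A_iff[of 3] type_A_iff[of 5] pivoted(1) by auto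
  qed
qed

text \<open>The determinant of what is left of \<open>G5\<close> after eliminating the edge \<open>23\<close>, for the gains
  \<open>a, b, c, d, e\<close> of the arcs \<open>12, 13, 23, 24, 34\<close> and their inverses. It depends only on the gain of
  the cycle \<open>1, 2, 4, 3\<close>, although the diagonal entries come from the two triangles.\<close>

lemma diamond_determinant:
  fixes a b c d e a' b' c' d' e' :: complex
  assumes "a * a' = 1" "b * b' = 1" "c * c' = 1" "d * d' = 1" "e * e' = 1"
  shows "(a * c * b' + a' * c' * b) * (d' * c * e + d * c' * e')
      - (a * c * e + b * c' * d) * (a' * c' * e' + b' * c * d')
    = a * d * e' * b' + a' * d' * e * b - 2"
  using assms by algebra


text \<open>The edge \<open>23\<close> is eliminated, and a hermitian block on the vertices 1 and 4 remains. Its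
  determinant vanishes exactly if the unit gain of the four-cycle \<open>1, 2, 4, 3\<close> has real part 1, that
  is, equals 1. In that case both triangles have the same real part, so the block is zero as soon as
  its first diagonal entry is.\<close>

lemma rank_G5:
  assumes "labelling G5 G l"
  shows "rank A =
    (if type_B \<phi> (map l [1,2,4,3]) then 4 else if type_E \<phi> (map l [1,2,3]) then 2 else 3)"
proof -
  note lab = assms[unfolded G5_def]
  note entry = labelled_entry[OF lab, simplified] and gain = labelled_gains[OF lab, simplified]
  let ?M = "edge_pivot (l 2) (l 3) A"
  let ?g = "\<phi> (l 1, l 2) * \<phi> (l 2, l 4) * cnj (\<phi> (l 3, l 4)) * cnj (\<phi> (l 1, l 3))"
  have labels: "{1..4::nat} = {1, 2, 3, 4}"
    by auto
  have inj: "inj_on l {1..4}"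
    using lab by (simp add: labelling_def labelled_graph_def bij_betw_def)
  then have neq: "l 1 \<noteq> l 4"
    by (auto dest!: inj_onD[of l _ 1 4])
  note pivoted = rank_labelled_one_pivot[OF lab, of 2 3, simplified]
  have off: "?M $ i $ j = 0" if "i \<notin> {l 1, l 4} \<or> j \<notin> {l 1, l 4}" for i j
    using that pivoted(2-5) labelled_vertex[OF lab, of i] labelled_vertex[OF lab, of j]
    unfolding labels by (smt (verit) insert_iff singletonD)
  have herm: "?M $ j $ i = cnj (?M $ i $ j)" for i j
    using hermitian_edge_pivot[OF hermitian_A] unfolding hermitian_def by blast
  have M11: "?M $ l 1 $ l 1 = - (\<phi> (l 1, l 2) * \<phi> (l 2, l 3) * cnj (\<phi> (l 1, l 3))
      + cnj (\<phi> (l 1, l 2)) * cnj (\<phi> (l 2, l 3)) * \<phi> (l 1, l 3))"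
    and M44: "?M $ l 4 $ l 4 = - (cnj (\<phi> (l 2, l 4)) * \<phi> (l 2, l 3) * \<phi> (l 3, l 4)
      + \<phi> (l 2, l 4) * cnj (\<phi> (l 2, l 3)) * cnj (\<phi> (l 3, l 4)))"
    and M14: "?M $ l 1 $ l 4 = - (\<phi> (l 1, l 2) * \<phi> (l 2, l 3) * \<phi> (l 3, l 4)
      + \<phi> (l 1, l 3) * cnj (\<phi> (l 2, l 3)) * \<phi> (l 2, l 4))"
    and M41: "?M $ l 4 $ l 1 = - (cnj (\<phi> (l 1, l 2)) * cnj (\<phi> (l 2, l 3)) * cnj (\<phi> (l 3, l 4))
      + cnj (\<phi> (l 1, l 3)) * \<phi> (l 2, l 3) * cnj (\<phi> (l 2, l 4)))"
    by (simp_all add: edge_pivot_def entry gain algebra_simps)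
  have "?M $ l 1 $ l 1 * ?M $ l 4 $ l 4 - ?M $ l 1 $ l 4 * ?M $ l 4 $ l 1 =
      \<phi> (l 1, l 2) * \<phi> (l 2, l 4) * cnj (\<phi> (l 3, l 4)) * cnj (\<phi> (l 1, l 3))
      + cnj (\<phi> (l 1, l 2)) * cnj (\<phi> (l 2, l 4)) * \<phi> (l 3, l 4) * \<phi> (l 1, l 3) - 2"
    unfolding M11 M44 M14 M41 minus_mult_minus
    by (rule diamond_determinant) (simp_all add: gain)
  also have "\<dots> = of_real (2 * (Re ?g - 1))"
    using complex_add_cnj[of ?g] by simp
  finally have det: "?M $ l 1 $ l 1 * ?M $ l 4 $ l 4 = ?M $ l 1 $ l 4 * ?M $ l 4 $ l 1 \<longleftrightarrow> Re ?g = 1"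
    by (metis (no_types, lifting) mult_eq_0_iff of_real_eq_0_iff right_minus_eq zero_neq_numeral)
  have unit_g: "?g * cnj ?g = 1"
  proof -
    have "(a * d * e' * b') * (a' * d' * e * b) = 1"
      if "a * a' = 1" "b * b' = 1" "d * d' = 1" "e * e' = 1" for a a' b b' d d' e e' :: complex
      using that by algebra
    then show ?thesis
      by (simp add: gain)
  qed
  have "Re ?g = 1 \<longleftrightarrow> ?g = 1"
  proof
    assume "Re ?g = 1"
    moreover have "(Re ?g)\<^sup>2 + (Im ?g)\<^sup>2 = 1"
      using unit_g by (metis cmod_power2 complex_norm_square of_real_eq_1_iff)
    ultimately show "?g = 1"
      by (simp add: complex_eq_iff)
  qed simp
  also have "?g = 1 \<longleftrightarrow> \<phi> (l 1, l 2) * \<phi> (l 2, l 4) * cnj (\<phi> (l 3, l 4)) = \<phi> (l 1, l 3)"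
    using unit_transfer[of 1 "cnj (\<phi> (l 1, l 3))" _ 1] by (simp add: gain)
  finally have g: "Re ?g = 1 \<longleftrightarrow> \<phi> (l 1, l 2) * \<phi> (l 2, l 4) * cnj (\<phi> (l 3, l 4)) = \<phi> (l 1, l 3)" .
  have type_B: "type_B \<phi> (map l [1,2,4,3]) \<longleftrightarrow> Re ?g \<noteq> 1"
    unfolding g by (auto simp: cycle_type_defs gain mult_ac)
  have M11_eq_M44: "?M $ l 1 $ l 1 = ?M $ l 4 $ l 4" if "Re ?g = 1"
  proof -
    have identity: "a * c * b' + a' * c' * b = d' * c * e + d * c' * e'"
      if "a * a' = 1" "a * d * e' = b" "a' * d' * e = b'" for a a' b b' c c' d d' e e' :: complex
      using that by algebra
    have b: "\<phi> (l 1, l 2) * \<phi> (l 2, l 4) * cnj (\<phi> (l 3, l 4)) = \<phi> (l 1, l 3)"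
      using that g by blast
    show ?thesis
      unfolding M11 M44 using identity[OF _ b] arg_cong[OF b, of cnj] by (simp add: gain)
  qed
  have type_E: "?M $ l 1 $ l 1 = 0 \<longleftrightarrow> type_E \<phi> (map l [1,2,3])"
  proof -
    have "?M $ l 1 $ l 1 = of_real (2 * Re ((-1) ^ 1 * prod_list (cycle_gains \<phi> (map l [1,2,3]))))"
      by (simp add: M11 gain cycle_gains_def complex_eq_iff algebra_simps)
    then show ?thesis
      by (simp only: of_real_eq_0_iff mult_eq_0_iff) (simp add: type_E_def)
  qed
  have "?M $ l 1 $ l 4 = 0 \<longleftrightarrow> ?M $ l 4 $ l 1 = 0"
    using herm[of "l 1" "l 4"] by (metis complex_cnj_zero_iff)
  then have "rank ?M = (if Re ?g \<noteq> 1 then 2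
      else if ?M $ l 1 $ l 1 = 0 \<and> ?M $ l 4 $ l 4 = 0 then 0 else 1)"
    using rank_2x2_block[of "l 1" "l 4" ?M] off neq det by simp
  then show ?thesis
    unfolding type_B type_E[symmetric] using pivoted(1) M11_eq_M44 by auto
qed

end

section \<open>Bicyclic gain graphs of rank at most four\<close>

lemma (in low_rank_bicyclic_gain_graph) low_rank_shapes:
  "(\<exists>l. labelling G1 G l) \<or> (\<exists>l. labelling G2 G l) \<or> (\<exists>l. labelling G3 G l) \<or> (\<exists>l. labelling G5 G l)
   \<or> (\<exists>l. labelling G6 G l) \<or> (\<exists>l. labelling G7 G l) \<or> (\<exists>l. labelling G8 G l) \<or> (\<exists>l. labelling G9 G l)
   \<or> (\<exists>l. labelling G10 G l) \<or> (\<exists>l. labelling G11 G l)"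
proof (cases rule: branch_vertices)
  case (one c)
  then show ?thesis
    using one_branch_vertex by blast
next
  case (two u v)
  then show ?thesis
    using adjacent_branch_vertices[of u v] nonadjacent_branch_vertices[of u v] by blast
qed

lemma type_B_iff: "even (length vs) \<Longrightarrow> type_B \<phi> vs \<longleftrightarrow> \<not> type_A \<phi> vs"
  by (simp add: type_A_def type_B_def)

lemma type_C_or_D_iff: "odd (length vs) \<Longrightarrow> type_C \<phi> vs \<or> type_D \<phi> vs \<longleftrightarrow> \<not> type_E \<phi> vs"
  unfolding type_C_def type_D_def type_E_def by (smt (verit))

theorem theorem4p1:
  fixes G :: "'v::finite pair_pre_digraph" and \<phi> :: "'v \<times> 'v \<Rightarrow> complex"
  assumes "gain_graph G \<phi>" and "pverts G = UNIV"
    and "bicyclic G" and "\<nexists>v. pendant_vertex G v"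
  shows
   "(gain_rank G \<phi> = 2 \<longleftrightarrow>
       (\<exists>l. labelling G5 G l \<and> type_E \<phi> (map l [1,2,3]) \<and> type_A \<phi> (map l [1,2,4,3]))
     \<or> (\<exists>l. labelling G9 G l \<and> type_A \<phi> (map l [1,2,3,4]) \<and> type_A \<phi> (map l [1,2,5,4])))
  \<and> (gain_rank G \<phi> = 3 \<longleftrightarrow>
       (\<exists>l. labelling G5 G l \<and> (type_C \<phi> (map l [1,2,3]) \<or> type_D \<phi> (map l [1,2,3]))
            \<and> type_A \<phi> (map l [1,2,4,3])))
  \<and> (gain_rank G \<phi> = 4 \<longleftrightarrow>
       (\<exists>l. labelling G1 G l
            \<and> Re (- \<phi> (l 1, l 5) * (\<phi> (l 5, l 2) / \<phi> (l 1, l 2)))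
              + Re (- \<phi> (l 3, l 5) * (\<phi> (l 5, l 4) / \<phi> (l 3, l 4))) = 0)
     \<or> (\<exists>l. labelling G2 G l \<and> type_A \<phi> (map l [3,4,5,6]) \<and> type_E \<phi> (map l [1,2,3]))
     \<or> (\<exists>l. labelling G3 G l \<and> type_A \<phi> (map l [1,2,4,3]) \<and> type_A \<phi> (map l [4,5,6,7]))
     \<or> (\<exists>l. labelling G5 G l
            \<and> (type_C \<phi> (map l [1,2,3]) \<or> type_D \<phi> (map l [1,2,3]) \<or> type_E \<phi> (map l [1,2,3]))
            \<and> type_B \<phi> (map l [1,2,4,3]))
     \<or> (\<exists>l. labelling G6 G l
            \<and> Re (- \<phi> (l 1, l 5) * (\<phi> (l 5, l 2) / \<phi> (l 1, l 2)))
              + Re ((\<phi> (l 1, l 5) * \<phi> (l 3, l 2) * \<phi> (l 5, l 4))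
                    / (\<phi> (l 1, l 2) * \<phi> (l 3, l 4))) = 0)
     \<or> (\<exists>l. labelling G7 G l \<and> type_E \<phi> (map l [1,2,6]) \<and> type_A \<phi> (map l [1,2,3,4,5,6]))
     \<or> (\<exists>l. labelling G8 G l
            \<and> \<phi> (l 1, l 6) * \<phi> (l 3, l 2) * \<phi> (l 5, l 4)
              - \<phi> (l 1, l 6) * \<phi> (l 3, l 4) * \<phi> (l 5, l 2)
              + \<phi> (l 1, l 2) * \<phi> (l 3, l 4) * \<phi> (l 5, l 6) = 0)
     \<or> (\<exists>l. labelling G9 G l
            \<and> ((type_A \<phi> (map l [1,2,3,4]) \<and> type_B \<phi> (map l [1,2,5,4]))
               \<or> (type_B \<phi> (map l [1,2,3,4])
                  \<and> (type_A \<phi> (map l [1,2,5,4]) \<or> type_B \<phi> (map l [1,2,5,4])))))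
     \<or> (\<exists>l. labelling G10 G l \<and> type_E \<phi> (map l [1,2,3,4,5]) \<and> type_A \<phi> (map l [1,2,6,5]))
     \<or> (\<exists>l. labelling G11 G l \<and> type_A \<phi> (map l [1,2,3,4,5,6]) \<and> type_A \<phi> (map l [1,2,7,6])))"
proof -
  interpret bicyclic_gain_graph G \<phi>
    using assms by (simp add: bicyclic_gain_graph_def bicyclic_gain_graph_axioms_def
        spanning_gain_graph_def spanning_gain_graph_axioms_def)
  have shapes: "(\<exists>l. labelling G1 G l) \<or> (\<exists>l. labelling G2 G l) \<or> (\<exists>l. labelling G3 G l)
      \<or> (\<exists>l. labelling G5 G l) \<or> (\<exists>l. labelling G6 G l) \<or> (\<exists>l. labelling G7 G l)
      \<or> (\<exists>l. labelling G8 G l) \<or> (\<exists>l. labelling G9 G l) \<or> (\<exists>l. labelling G10 G l)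
      \<or> (\<exists>l. labelling G11 G l)" if "rank A \<le> 4"
  proof -
    interpret low_rank_bicyclic_gain_graph G \<phi>
      using that by unfold_locales
    show ?thesis
      by (rule low_rank_shapes)
  qed
  have B_iff: "type_B \<phi> (map l [a, b, c, d]) \<longleftrightarrow> \<not> type_A \<phi> (map l [a, b, c, d])"
    for l :: "nat \<Rightarrow> 'v" and a b c d
    by (rule type_B_iff) simp
  have CD_iff: "type_C \<phi> (map l [a, b, c]) \<or> type_D \<phi> (map l [a, b, c]) \<longleftrightarrow> \<not> type_E \<phi> (map l [a, b, c])"
    for l :: "nat \<Rightarrow> 'v" and a b c
    by (rule type_C_or_D_iff) simp
  note at_least_4 = rank_G1(1) rank_G2(1) rank_G3(1) rank_G6(1) rank_G7(1) rank_G8(1) rank_G10(1) rank_G11(1)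
  have small: "(\<exists>l. labelling G5 G l) \<or> (\<exists>l. labelling G9 G l)" if "rank A < 4"
    using shapes that at_least_4 by (meson less_imp_le not_less)
  have rank_2: "rank A = 2 \<longleftrightarrow> type_E \<phi> (map l [1,2,3]) \<and> type_A \<phi> (map l [1,2,4,3])"
    and rank_3: "rank A = 3 \<longleftrightarrow> (type_C \<phi> (map l [1,2,3]) \<or> type_D \<phi> (map l [1,2,3])) \<and> type_A \<phi> (map l [1,2,4,3])"
    and rank_4: "rank A = 4 \<longleftrightarrow>
      (type_C \<phi> (map l [1,2,3]) \<or> type_D \<phi> (map l [1,2,3]) \<or> type_E \<phi> (map l [1,2,3])) \<and> type_B \<phi> (map l [1,2,4,3])"
    if "labelling G5 G l" for l
    using rank_G5[OF that] B_iff[of l 1 2 4 3] CD_iff[of l 1 2 3] by (auto split: if_splits)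
  have rank_2': "rank A = 2 \<longleftrightarrow> type_A \<phi> (map l [1,2,3,4]) \<and> type_A \<phi> (map l [1,2,5,4])"
    and not_3: "rank A \<noteq> 3"
    and rank_4': "rank A = 4 \<longleftrightarrow> type_A \<phi> (map l [1,2,3,4]) \<and> type_B \<phi> (map l [1,2,5,4])
      \<or> type_B \<phi> (map l [1,2,3,4]) \<and> (type_A \<phi> (map l [1,2,5,4]) \<or> type_B \<phi> (map l [1,2,5,4]))"
    if "labelling G9 G l" for l
    using rank_G9[OF that] B_iff[of l 1 2 3 4] B_iff[of l 1 2 5 4] by (auto split: if_splits)
  have small_2: "(\<exists>l. labelling G5 G l) \<or> (\<exists>l. labelling G9 G l)" if "rank A = 2"
    using small that by simp
  have small_3: "\<exists>l. labelling G5 G l" if "rank A = 3"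
    using small that not_3 by auto
  note criteria = rank_2 rank_2' rank_3 rank_4 rank_4' rank_G1(2) rank_G2(2) rank_G3(2) rank_G6(2)
    rank_G7(2) rank_G8(2) rank_G10(2) rank_G11(2)
  (* Under the hypothesis that l is a labelling, each gain condition can be replaced by the rank that
     it characterises; what remains is the classification of the underlying graphs. *)
  show ?thesis
    unfolding gain_rank_def
    by (simp only: criteria[symmetric] ex_simps cong: conj_cong)
      (use shapes small_2 small_3 in auto)
qed

end
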